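(* Let $(\bar N,g)$ be an $n$-dimensional Riemannian manifold isometrically embedded in $\mathbb{R}^S$, $N\subset\bar N$ compact, and $1\le m\le n-1$. The following are equivalent: (i) $N$ contains no non-zero $m$-varifold with null generalized second fundamental form; (ii) there exist an increasing function $\Phi:[0,\infty)\to[0,\infty)$ with $\Phi(0)=0$ and a function $F:G_m(N)\times\mathbb{R}^{S^3}\to[0,\infty)$ satisfying condition (F) such that every $m$-varifold $V$ on $N$ with generalized second fundamental form $A$ satisfies $|V|\le\Phi\big(\int_{G_m(N)}F(x,P,A)\,dV\big)$; (iii) for every $F:G_m(N)\times\mathbb{R}^{S^3}\to[0,\infty)$ satisfying condition (F) there is $C_F>0$ such that every $m$-varifold $V$ on $N$ with generalized second fundamental form $A$ satisfies $|V|\le C_F\int_{G_m(N)}F(x,P,A)\,dV$.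
   Context: $G(S,m)$ is the Grassmannian of $m$-planes in $\mathbb{R}^S$, each $P$ identified with its orthogonal projection matrix $(P_{ij})$; $Q(x)=(Q_{ij}(x))$ is the orthogonal projection onto $T_x\bar N$; $G_m(N)=\{(x,P):x\in N,\ P\subset T_x\bar N\}$. An $m$-varifold on $N$ is any Radon measure $V$ on $G_m(N)$ (not necessarily rectifiable); $|V|=V(G_m(N))$. $V$ has generalized curvature $B=(B_{ijk})$, $B_{ijk}\in L^1_{loc}(V)$, if for all $\phi\in C^1_c(\mathbb{R}^S\times\mathbb{R}^{S\times S})$ and each $i$: $0=\int_{G_m(N)}[P_{ij}D_j\phi+B_{ijk}D^*_{jk}\phi+B_{jij}\phi]\,dV$ (summation convention; $D_j$ derivative in $x_j$, $D^*_{jk}$ derivative in $P_{jk}$); its generalized second fundamental form is $A^k_{ij}=P_{lj}B_{ikl}-P_{lj}P_{iq}\partial_{x_q}Q_{kl}(x)$. Condition (F) on $F:G_m(N)\times\mathbb{R}^\alpha\to\mathbb{R}$: (i) continuous; (ii) $F\ge0$, and $F(x,P,q)=0$ iff $q=0$; (iii) convex in $q$; (iv) there is a continuous $\phi:G_m(N)\times[0,\infty)\to[0,\infty)$, nondecreasing in the last variable, with $\phi(x,P,t)\to\infty$ locally uniformly as $t\to\infty$, such that $\phi(x,P,|q|)|q|\le F(x,P,q)$. *)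

theory Defs
  imports "HOL-Analysis.Analysis"
begin

primrec Ck_on :: "nat \<Rightarrow> 'a::euclidean_space set \<Rightarrow> ('a \<Rightarrow> 'b::real_normed_vector) \<Rightarrow> bool" where
  "Ck_on 0 W f = continuous_on W f"
| "Ck_on (Suc k) W f =
     ((\<forall>x\<in>W. f differentiable (at x)) \<and>
      (\<forall>v. Ck_on k W (\<lambda>x. frechet_derivative f (at x) v)))"

definition smooth_on :: "'a::euclidean_space set \<Rightarrow> ('a \<Rightarrow> 'b::real_normed_vector) \<Rightarrow> bool" where
  "smooth_on W f \<longleftrightarrow> (\<forall>k. Ck_on k W f)"

definition embedded_submanifold :: "'n::finite itself \<Rightarrow> (real^'s) set \<Rightarrow> bool" where
  "embedded_submanifold _ M \<longleftrightarrow>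
     (\<forall>p\<in>M. \<exists>U (W::(real^'n) set) (\<phi>::real^'n \<Rightarrow> real^'s).
        open U \<and> p \<in> U \<and> open W \<and> smooth_on W \<phi> \<and> \<phi> ` W = M \<inter> U \<and> inj_on \<phi> W \<and>
        continuous_on (M \<inter> U) (inv_into W \<phi>) \<and>
        (\<forall>u\<in>W. inj (frechet_derivative \<phi> (at u))))"

definition tangent_space :: "(real^'s) set \<Rightarrow> real^'s \<Rightarrow> (real^'s) set" where
  "tangent_space M x = {v. \<exists>\<gamma> e. e > 0 \<and> (\<forall>t\<in>{-e<..<e}. \<gamma> t \<in> M) \<and> \<gamma> 0 = x \<and>
                               (\<gamma> has_vector_derivative v) (at 0)}"

definition is_orth_proj :: "(real^'s) set \<Rightarrow> real^'s^'s \<Rightarrow> bool" where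
  "is_orth_proj T P \<longleftrightarrow> transpose P = P \<and> P ** P = P \<and> range (\<lambda>v. P *v v) = T"

text \<open>Grassmannian G(S,m) of m-planes, as orthogonal projection matrices.\<close>
definition Grass :: "nat \<Rightarrow> (real^'s^'s) set" where
  "Grass m = {P. transpose P = P \<and> P ** P = P \<and> rank P = m}"

definition Gm :: "nat \<Rightarrow> (real^'s) set \<Rightarrow> (real^'s) set \<Rightarrow> ((real^'s) \<times> (real^'s^'s)) set" where
  "Gm m Nbar N = {(x, P). x \<in> N \<and> P \<in> Grass m \<and> range (\<lambda>v. P *v v) \<subseteq> tangent_space Nbar x}"

text \<open>An m-varifold on N: a Radon (= finite Borel, G_m(N) being compact) measure carried by G_m(N).\<close>
definition varifold :: "nat \<Rightarrow> (real^'s) set \<Rightarrow> (real^'s) set \<Rightarrow> ((real^'s) \<times> (real^'s^'s)) measure \<Rightarrow> bool" where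
  "varifold m Nbar N V \<longleftrightarrow> sets V = sets borel \<and> emeasure V (space V) < \<infinity> \<and>
     emeasure V (space V - Gm m Nbar N) = 0"

definition C1c :: "((real^'s) \<times> (real^'s^'s) \<Rightarrow> real) \<Rightarrow> bool" where
  "C1c \<phi> \<longleftrightarrow> Ck_on 1 UNIV \<phi> \<and> compact (closure {z. \<phi> z \<noteq> 0})"

definition Dx :: "((real^'s) \<times> (real^'s^'s) \<Rightarrow> real) \<Rightarrow> 's \<Rightarrow> (real^'s) \<times> (real^'s^'s) \<Rightarrow> real" where
  "Dx \<phi> j z = frechet_derivative \<phi> (at z) (axis j 1, 0)"

definition DP :: "((real^'s) \<times> (real^'s^'s) \<Rightarrow> real) \<Rightarrow> 's \<Rightarrow> 's \<Rightarrow> (real^'s) \<times> (real^'s^'s) \<Rightarrow> real" where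
  "DP \<phi> j k z = frechet_derivative \<phi> (at z) (0, axis j (axis k 1))"

definition gen_curvature :: "((real^'s) \<times> (real^'s^'s)) measure \<Rightarrow>
    ((real^'s) \<times> (real^'s^'s) \<Rightarrow> real^'s^'s^'s) \<Rightarrow> bool" where
  "gen_curvature V B \<longleftrightarrow>
     (\<forall>i j k. integrable V (\<lambda>z. B z $ i $ j $ k)) \<and>
     (\<forall>\<phi> i. C1c \<phi> \<longrightarrow>
        (\<integral>z. (\<Sum>j\<in>UNIV. (snd z) $ i $ j * Dx \<phi> j z)
             + (\<Sum>j\<in>UNIV. \<Sum>k\<in>UNIV. B z $ i $ j $ k * DP \<phi> j k z)
             + (\<Sum>j\<in>UNIV. B z $ j $ i $ j) * \<phi> z \<partial>V) = 0)"

text \<open>Generalized second fundamental form: (sff Q B z) $ i $ j $ k = A^k_ij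
  = P_lj B_ikl - P_lj P_iq \<partial>_q Q_kl(x).\<close>
definition sff :: "(real^'s \<Rightarrow> real^'s^'s) \<Rightarrow> ((real^'s) \<times> (real^'s^'s) \<Rightarrow> real^'s^'s^'s) \<Rightarrow>
    (real^'s) \<times> (real^'s^'s) \<Rightarrow> real^'s^'s^'s" where
  "sff Q B z = (\<chi> i j k. (\<Sum>l\<in>UNIV. (snd z) $ l $ j * B z $ i $ k $ l)
      - (\<Sum>l\<in>UNIV. \<Sum>q\<in>UNIV. (snd z) $ l $ j * (snd z) $ i $ q *
            (frechet_derivative Q (at (fst z)) (axis q 1)) $ k $ l))"

definition condF :: "((real^'s) \<times> (real^'s^'s)) set \<Rightarrow>
    ((real^'s) \<times> (real^'s^'s) \<Rightarrow> real^'s^'s^'s \<Rightarrow> real) \<Rightarrow> bool" where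
  "condF G F \<longleftrightarrow>
     continuous_on (G \<times> UNIV) (\<lambda>(z, q). F z q) \<and>
     (\<forall>z\<in>G. \<forall>q. F z q \<ge> 0 \<and> (F z q = 0 \<longleftrightarrow> q = 0)) \<and>
     (\<forall>z\<in>G. convex_on UNIV (F z)) \<and>
     (\<exists>\<psi> :: (real^'s) \<times> (real^'s^'s) \<Rightarrow> real \<Rightarrow> real.
        continuous_on (G \<times> {0..}) (\<lambda>(z, t). \<psi> z t) \<and>
        (\<forall>z\<in>G. \<forall>t\<ge>0. \<psi> z t \<ge> 0) \<and>
        (\<forall>z\<in>G. mono_on {0..} (\<psi> z)) \<and>
        (\<forall>z0\<in>G. \<exists>e>0. \<forall>M. \<exists>T. \<forall>t\<ge>T. \<forall>z\<in>G \<inter> ball z0 e. \<psi> z t \<ge> M) \<and>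
        (\<forall>z\<in>G. \<forall>q. \<psi> z (norm q) * norm q \<le> F z q))"

end

theory Submission
  imports Defs "HOL-Probability.Probability"
begin

text \<open>
  The substantial implication is (i) to (iii). If (iii) fails for \<open>F\<close>, there are varifolds \<open>V\<^sub>n\<close>, which
  may be normalised to mass one, whose energy tends to zero. By convexity, \<open>|q| \<le> \<epsilon> + C\<^sub>\<epsilon> F(z, q)\<close> on
  the compact set \<open>G\<^sub>m(N)\<close>, so the second fundamental forms \<open>A\<^sub>n\<close> tend to zero in \<open>L\<^sup>1\<close>. Testing the
  curvature identity with functions vanishing on the Grassmannian shows that \<open>B\<close> is almost everywhere a
  linear function of \<open>A\<close> plus a fixed continuous function of \<open>(x, P)\<close>. Hence the curvature identity
  passes to a weak limit of the \<open>V\<^sub>n\<close>, which has mass one; its second fundamental form vanishes because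
  \<open>P (\<partial>\<^sub>v Q) P = 0\<close> for \<open>v\<close> tangent to \<open>Nbar\<close>, contradicting (i).

  Weak compactness of probability measures on a compact subset of a Euclidean space is obtained by
  lifting them to the line through Schoenberg's space-filling curve.
\<close>

section \<open>Weak compactness\<close>

text \<open>Normalising is harmless because the curvature identity is linear in \<open>V\<close>:
  rescaling keeps \<open>B\<close>, hence the second fundamental form, and multiplies both sides of
  the violated inequality by the same factor. The obstacle is that each \<open>V n\<close> has its
  own function \<open>B n\<close>, and smallness of one part of it gives no limit function. An exact
  algebraic formula removes the difficulty: with \<open>R i\<close> the derivative of
  \<open>Q\<close> along \<open>P e_i\<close>, the product of \<open>B_i\<close> and
  \<open>P\<close> is the transposed second fundamental form plus the product of \<open>R i\<close>
  and \<open>P\<close>, and this product determines \<open>B_i\<close>. The part of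
  \<open>B n\<close> that survives is thus known in advance and does not depend on \<open>n\<close>,
  so convergence against continuous functions suffices. As \<open>Q\<close> is C1 only on the open
  set \<open>U0\<close>, its partial derivatives are restricted to \<open>N\<close> and extended
  continuously to the whole space.

  The other implications are short: the squared norm with a linear \<Phi> gives (iii) to (ii), and
  \<Phi>(0) = 0 forces flat varifolds to vanish, which gives (ii) to (i).\<close>

definition cantor_point :: "(nat \<Rightarrow> real) \<Rightarrow> real" where
  "cantor_point d = (\<Sum>n. 2 * d n * (1/3) ^ Suc n)"

text \<open>A continuous function of period 2 that is 0 on [0, 1/3] and 1 on [2/3, 1], where the
  cosine is at least 1/2 and at most -1/2 respectively. The clamped cosine stands for the usual
  piecewise linear wave, so that periodicity is inherited from \<open>cos\<close>.\<close>

definition schoenberg_wave :: "real \<Rightarrow> real" where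
  "schoenberg_wave t = max 0 (min 1 (1/2 - cos (pi * t)))"

lemma cantor_point_summable:
  assumes "\<And>n. d n \<in> {0, 1::real}"
  shows "summable (\<lambda>n. 2 * d n * (1/3) ^ Suc n)"
proof (rule summable_comparison_test)
  show "\<exists>N. \<forall>n\<ge>N. norm (2 * d n * (1/3) ^ Suc n) \<le> 2 * (1/3) ^ n"
  proof (intro exI allI impI)
    fix n
    show "norm (2 * d n * (1/3) ^ Suc n) \<le> 2 * (1/3) ^ n"
      using assms[of n] by auto
  qed
  show "summable (\<lambda>n. 2 * (1/3::real) ^ n)"
    by (intro summable_mult summable_geometric) auto
qed

lemma cantor_point_bounds:
  assumes d: "\<And>n. d n \<in> {0, 1::real}"
  shows "0 \<le> cantor_point d" "cantor_point d \<le> 1"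
proof -
  have nonneg: "0 \<le> d n" "d n \<le> 1" for n
    using d[of n] by auto
  show "0 \<le> cantor_point d"
    unfolding cantor_point_def by (intro suminf_nonneg cantor_point_summable d) (simp add: nonneg)
  have "(\<lambda>n. 2/3 * (1/3::real) ^ n) sums (2/3 * (1 / (1 - 1/3)))"
    by (intro sums_mult geometric_sums) auto
  then have s: "(\<lambda>n. 2/3 * (1/3::real) ^ n) sums 1"
    by simp
  have "cantor_point d \<le> (\<Sum>n. 2/3 * (1/3::real) ^ n)"
    unfolding cantor_point_def
    using nonneg by (intro suminf_le cantor_point_summable d sums_summable[OF s]) simp
  then show "cantor_point d \<le> 1"
    using sums_unique[OF s] by simp
qed

lemma cantor_point_shift:
  assumes d: "\<And>n. d n \<in> {0, 1::real}"
  shows "3 * cantor_point d = 2 * d 0 + cantor_point (\<lambda>n. d (Suc n))"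
proof -
  have "cantor_point d = 2 * d 0 / 3 + (\<Sum>n. 2 * d (Suc n) * (1/3) ^ Suc (Suc n))"
    unfolding cantor_point_def using suminf_split_head[OF cantor_point_summable[of d], OF d] by simp
  also have "(\<Sum>n. 2 * d (Suc n) * (1/3) ^ Suc (Suc n)) = (\<Sum>n. (2 * d (Suc n) * (1/3) ^ Suc n) * (1/3))"
    by (simp add: mult_ac)
  also have "\<dots> = cantor_point (\<lambda>n. d (Suc n)) * (1/3)"
    unfolding cantor_point_def
    using suminf_mult2[OF cantor_point_summable[of "\<lambda>n. d (Suc n)"], of "1/3"] d by simp
  finally show ?thesis by simp
qed

text \<open>\<open>cantor_point d\<close> has ternary digits \<open>2 * d n\<close>, so
  multiplication by 3 shifts the digits and adds \<open>2 * d 0\<close>, which after further powers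
  of 3 is still a multiple of the period 2. Only the leading digit matters then: it puts the point
  into [0, 1/3] or [2/3, 1], where the wave is constant.\<close>

lemma schoenberg_wave_cantor_point:
  assumes "\<And>n. d n \<in> {0, 1::real}"
  shows "schoenberg_wave (3 ^ m * cantor_point d) = d m"
  using assms
proof (induction m arbitrary: d)
  case 0
  define s where "s = cantor_point (\<lambda>n. d (Suc n))"
  have s: "0 \<le> s" "s \<le> 1"
    unfolding s_def using cantor_point_bounds[of "\<lambda>n. d (Suc n)"] 0 by auto
  have c: "cantor_point d = (2 * d 0 + s) / 3"
    using cantor_point_shift[of d] 0 by (simp add: s_def)
  consider "d 0 = 0" | "d 0 = 1"
    using 0[of 0] by auto
  then show ?case
  proof cases
    case 1
    have "cos (pi / 3) \<le> cos (pi * (s / 3))"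
      using s by (intro cos_monotone_0_pi_le) (auto simp: mult_le_cancel_left1 mult_left_le)
    then show ?thesis
      using 1 unfolding c by (simp add: schoenberg_wave_def cos_60)
  next
    case 2
    have "cos (pi * ((2 + s) / 3)) \<le> cos (2 * pi / 3)"
      using s pi_gt_zero by (intro cos_monotone_0_pi_le) (auto simp: field_simps)
    moreover have "cos (2 * pi / 3) = - (1/2)"
      using cos_120 by simp
    ultimately show ?thesis
      using 2 unfolding c by (simp add: schoenberg_wave_def)
  qed
next
  case (Suc m)
  define s where "s = cantor_point (\<lambda>n. d (Suc n))"
  have s3: "3 * cantor_point d = 2 * d 0 + s"
    unfolding s_def by (rule cantor_point_shift) (rule Suc.prems)
  have "pi * (3 ^ Suc m * cantor_point d) = pi * 3 ^ m * (3 * cantor_point d)"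
    by simp
  also have "\<dots> = pi * (3 ^ m * s) + d 0 * 3 ^ m * (2 * pi)"
    unfolding s3 by (simp add: algebra_simps)
  finally have arg: "pi * (3 ^ Suc m * cantor_point d) = pi * (3 ^ m * s) + d 0 * 3 ^ m * (2 * pi)" .
  have "cos (pi * (3 ^ m * s) + d 0 * 3 ^ m * (2 * pi)) = cos (pi * (3 ^ m * s))"
  proof -
    consider "d 0 = 0" | "d 0 = 1"
      using Suc.prems[of 0] by auto
    then show ?thesis
    proof cases
      case 2
      then show ?thesis
        using cos.plus_of_nat[of "pi * (3 ^ m * s)" "3 ^ m"] by simp
    qed simp
  qed
  then have "schoenberg_wave (3 ^ Suc m * cantor_point d) = schoenberg_wave (3 ^ m * s)"
    unfolding schoenberg_wave_def arg by simp
  also have "\<dots> = d (Suc m)"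
    unfolding s_def using Suc.IH[of "\<lambda>n. d (Suc n)"] Suc.prems by simp
  finally show ?case .
qed

section \<open>Binary digits and expansions\<close>

definition binary_digit :: "nat \<Rightarrow> real \<Rightarrow> real" where
  "binary_digit n x = of_int (\<lfloor>2 ^ Suc n * x\<rfloor> mod 2)"

lemma binary_digit_in: "binary_digit n x \<in> {0, 1}"
proof -
  have "\<lfloor>2 ^ Suc n * x\<rfloor> mod 2 = 0 \<or> \<lfloor>2 ^ Suc n * x\<rfloor> mod 2 = 1"
    by presburger
  then show ?thesis
    unfolding binary_digit_def by auto
qed

lemma measurable_binary_digit [measurable]: "binary_digit n \<in> borel_measurable borel"
proof -
  have "(\<lambda>x::real. \<lfloor>2 ^ Suc n * x\<rfloor> mod 2) \<in> measurable borel (count_space UNIV)"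
    by (rule measurable_compose[of _ _ "count_space UNIV"]) auto
  then have "(\<lambda>x::real. real_of_int (\<lfloor>2 ^ Suc n * x\<rfloor> mod 2)) \<in> borel_measurable borel"
    by (rule measurable_compose) simp
  then show ?thesis
    unfolding binary_digit_def[abs_def] .
qed

text \<open>The truncations \<open>a n\<close> lie within \<open>(1/2) ^ n\<close> of
  \<open>x\<close>, and consecutive ones differ by one digit term, so the series telescopes. The
  value \<open>x = 1\<close> is excluded since all digits produced by the floor would be 0
  there.\<close>

lemma binary_expansion:
  assumes "0 \<le> x" "x < 1"
  shows "(\<lambda>n. binary_digit n x * (1/2) ^ Suc n) sums x"
proof -
  define a where "a n = real_of_int \<lfloor>2 ^ n * x\<rfloor> * (1/2) ^ n" for n
  have step: "\<lfloor>2 ^ Suc n * x\<rfloor> = 2 * \<lfloor>2 ^ n * x\<rfloor> + \<lfloor>2 ^ Suc n * x\<rfloor> mod 2" for n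
  proof -
    have "\<lfloor>2 ^ Suc n * x\<rfloor> div 2 = \<lfloor>2 ^ n * x\<rfloor>"
      using floor_divide_real_eq_div[of 2 "2 ^ Suc n * x"] by simp
    then show ?thesis
      by (metis mult_div_mod_eq)
  qed
  have diff: "a (Suc n) - a n = binary_digit n x * (1/2) ^ Suc n" for n
  proof -
    have "real_of_int \<lfloor>2 ^ Suc n * x\<rfloor> = 2 * real_of_int \<lfloor>2 ^ n * x\<rfloor> + binary_digit n x"
      unfolding binary_digit_def by (subst step) simp
    then show ?thesis
      unfolding a_def by (simp add: algebra_simps)
  qed
  have "a \<longlonglongrightarrow> x"
  proof (rule tendsto_sandwich[of "\<lambda>n. x - (1/2) ^ n" _ _ "\<lambda>_. x"])
    have "x - (1/2) ^ n \<le> a n \<and> a n \<le> x" for n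
    proof -
      have "real_of_int \<lfloor>2 ^ n * x\<rfloor> \<le> 2 ^ n * x" "2 ^ n * x - 1 \<le> real_of_int \<lfloor>2 ^ n * x\<rfloor>"
        by linarith+
      then have "real_of_int \<lfloor>2 ^ n * x\<rfloor> * (1/2) ^ n \<le> 2 ^ n * x * (1/2) ^ n"
        "(2 ^ n * x - 1) * (1/2) ^ n \<le> real_of_int \<lfloor>2 ^ n * x\<rfloor> * (1/2) ^ n"
        by (intro mult_right_mono; simp)+
      then show ?thesis
        unfolding a_def by (simp add: power_divide field_simps)
    qed
    then show "\<forall>\<^sub>F n in sequentially. x - (1/2) ^ n \<le> a n" "\<forall>\<^sub>F n in sequentially. a n \<le> x"
      by auto
    have "(\<lambda>n. x - (1/2) ^ n) \<longlonglongrightarrow> x - 0"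
      by (intro tendsto_intros LIMSEQ_power_zero) auto
    then show "(\<lambda>n. x - (1/2) ^ n) \<longlonglongrightarrow> x"
      by simp
  qed auto
  then have "(\<lambda>n. a (Suc n) - a n) sums (x - a 0)"
    by (rule telescope_sums)
  moreover have "a 0 = 0"
    using assms by (simp add: a_def floor_eq_iff)
  ultimately show ?thesis
    by (simp add: diff)
qed

lemma continuous_schoenberg_wave: "continuous_on A schoenberg_wave"
  unfolding schoenberg_wave_def by (intro continuous_intros)

lemma schoenberg_wave_bounds: "0 \<le> schoenberg_wave t" "schoenberg_wave t \<le> 1"
  by (auto simp: schoenberg_wave_def)

text \<open>The coordinates of Schoenberg's space-filling curve; on the Cantor set the \<open>(n * D + i)\<close>-th
  ternary digit of the parameter becomes the \<open>n\<close>-th binary digit of coordinate \<open>i\<close>.\<close>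

definition schoenberg_coord :: "nat \<Rightarrow> nat \<Rightarrow> real \<Rightarrow> real" where
  "schoenberg_coord D i t = (\<Sum>n. (1/2) ^ Suc n * schoenberg_wave (3 ^ (n * D + i) * t))"

lemma continuous_schoenberg_coord: "continuous_on UNIV (schoenberg_coord D i)"
proof -
  have "uniform_limit UNIV
      (\<lambda>n t. \<Sum>k<n. (1/2) ^ Suc k * schoenberg_wave (3 ^ (k * D + i) * t))
      (schoenberg_coord D i) sequentially"
    unfolding schoenberg_coord_def[abs_def]
  proof (rule Weierstrass_m_test)
    show "norm ((1/2) ^ Suc n * schoenberg_wave (3 ^ (n * D + i) * t)) \<le> (1/2) ^ n" for n t
      using schoenberg_wave_bounds[of "3 ^ (n * D + i) * t"] by (simp add: abs_mult)
    show "summable (\<lambda>n. (1/2::real) ^ n)"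
      by (rule summable_geometric) auto
  qed
  then show ?thesis
    by (rule uniform_limit_theorem[rotated])
      (auto intro!: always_eventually continuous_intros continuous_on_compose2[OF continuous_schoenberg_wave])
qed

lemma schoenberg_coord_bounds: "0 \<le> schoenberg_coord D i t" "schoenberg_coord D i t \<le> 1"
proof -
  have sm: "summable (\<lambda>n. (1/2) ^ Suc n * schoenberg_wave (3 ^ (n * D + i) * t))"
  proof (rule summable_comparison_test)
    show "\<exists>N. \<forall>n\<ge>N. norm ((1/2) ^ Suc n * schoenberg_wave (3 ^ (n * D + i) * t)) \<le> (1/2) ^ Suc n"
      using schoenberg_wave_bounds by (auto simp: abs_mult intro!: exI[of _ 0])
    show "summable (\<lambda>n. (1/2::real) ^ Suc n)"
      using power_half_series by (rule sums_summable)
  qed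
  show "0 \<le> schoenberg_coord D i t"
    unfolding schoenberg_coord_def by (intro suminf_nonneg sm) (simp add: schoenberg_wave_bounds)
  have s: "(\<lambda>n. (1/2::real) ^ Suc n) sums 1"
    by (rule power_half_series)
  have "schoenberg_coord D i t \<le> (\<Sum>n. (1/2) ^ Suc n)"
    unfolding schoenberg_coord_def
    by (intro suminf_le sm sums_summable[OF s]) (simp add: schoenberg_wave_bounds)
  then show "schoenberg_coord D i t \<le> 1"
    using sums_unique[OF s] by simp
qed

text \<open>Hence every Borel measure on a bounded set is the image, under one fixed bounded continuous
  curve, of a measure on \<open>[0, 1]\<close>: this reduces weak compactness to Helly's theorem on the line.\<close>

lemma space_filling_curve_with_measurable_section:
  fixes K :: "'a::euclidean_space set"
  assumes "bounded K"
  obtains f :: "real \<Rightarrow> 'a" and \<sigma> :: "'a \<Rightarrow> real"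
  where "continuous_on UNIV f" "bounded (range f)" "\<sigma> \<in> borel_measurable borel"
    "\<And>x. 0 \<le> \<sigma> x" "\<And>x. \<sigma> x \<le> 1" "\<And>x. x \<in> K \<Longrightarrow> f (\<sigma> x) = x"
proof -
  obtain R where R: "R > 0" "\<And>x. x \<in> K \<Longrightarrow> norm x < R"
    using assms by (meson bounded_pos_less)
  define D where "D = DIM('a)"
  have D: "D > 0" by (simp add: D_def)
  obtain e :: "nat \<Rightarrow> 'a" where e: "bij_betw e {..<D} Basis"
    using ex_bij_betw_nat_finite[of "Basis :: 'a set"] by (auto simp: D_def atLeast0LessThan)
  \<comment> \<open>An affine map of (-R, R) onto (0, 1). The bound \<open>R\<close> is strict
    because \<open>binary_expansion\<close> fails at 1.\<close>
  define p where "p i x = (x \<bullet> e i + R) / (2 * R)" for i and x :: 'a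
  define d where "d x k = binary_digit (k div D) (p (k mod D) x)" for x k
  define \<sigma> where "\<sigma> x = cantor_point (d x)" for x
  define f where "f t = (\<Sum>i<D. (2 * R * schoenberg_coord D i t - R) *\<^sub>R e i)" for t
  have d: "d x k \<in> {0, 1}" for x k
    unfolding d_def by (rule binary_digit_in)
  show thesis
  proof (rule that[of f \<sigma>])
    show "continuous_on UNIV f"
      unfolding f_def by (intro continuous_intros continuous_on_subset[OF continuous_schoenberg_coord]) auto
    show "bounded (range f)"
    proof (rule boundedI)
      fix y assume "y \<in> range f"
      then obtain t where y: "y = f t" by auto
      have "norm (f t) \<le> (\<Sum>i<D. R)"
        unfolding f_def
      proof (rule sum_norm_le)
        fix i assume "i \<in> {..<D}"
        then have "e i \<in> Basis" using e by (auto simp: bij_betw_def)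
        moreover have "\<bar>2 * R * schoenberg_coord D i t - R\<bar> \<le> R"
          using schoenberg_coord_bounds[where D = D and i = i and t = t] R(1)
          by (auto simp: abs_le_iff)
        ultimately show "norm ((2 * R * schoenberg_coord D i t - R) *\<^sub>R e i) \<le> R"
          by simp
      qed
      then show "norm y \<le> (\<Sum>i<D. R)" using y by simp
    qed
    have [measurable]: "p i \<in> borel_measurable borel" for i
      unfolding p_def by measurable
    show "\<sigma> \<in> borel_measurable borel"
      unfolding \<sigma>_def cantor_point_def d_def by measurable
    show "0 \<le> \<sigma> x" "\<sigma> x \<le> 1" for x
      unfolding \<sigma>_def using cantor_point_bounds[of "d x"] d by auto
    fix x assume x: "x \<in> K"
    have coord: "schoenberg_coord D i (\<sigma> x) = p i x" if i: "i < D" for i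
    proof -
      have "e i \<in> Basis" using e i by (auto simp: bij_betw_def)
      then have "\<bar>x \<bullet> e i\<bar> < R"
        using Basis_le_norm[of "e i" x] R(2)[OF x] by linarith
      then have p: "0 \<le> p i x" "p i x < 1"
        using R(1) by (auto simp: p_def field_simps)
      have "schoenberg_wave (3 ^ (n * D + i) * \<sigma> x) = binary_digit n (p i x)" for n
        unfolding \<sigma>_def
        by (subst schoenberg_wave_cantor_point) (use d i in \<open>auto simp: d_def\<close>)
      then have "schoenberg_coord D i (\<sigma> x) = (\<Sum>n. binary_digit n (p i x) * (1/2) ^ Suc n)"
        unfolding schoenberg_coord_def by (simp add: mult.commute)
      also have "\<dots> = p i x"
        using binary_expansion[OF p] by (rule sums_unique[symmetric])
      finally show ?thesis .
    qed
    have "f (\<sigma> x) = (\<Sum>i<D. (x \<bullet> e i) *\<^sub>R e i)"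
      unfolding f_def using R(1) by (intro sum.cong) (auto simp: coord p_def)
    also have "\<dots> = (\<Sum>b\<in>Basis. (x \<bullet> b) *\<^sub>R b)"
      by (rule sum.reindex_bij_betw[OF e])
    finally show "f (\<sigma> x) = x" by (simp add: euclidean_representation)
  qed
qed

text \<open>The section \<sigma> transports the measures to [0, 1], where tightness is automatic;
  the limit on the line is pushed back by \<open>f\<close>, and \<open>f\<close> after \<sigma> is
  the identity on \<open>K\<close>. Since \<sigma> is only measurable, the limit on the line may
  charge parameters outside the image of \<open>K\<close>, so that the limit lives on
  \<open>K\<close> has to be shown separately.\<close>

lemma weak_limit_of_compactly_supported:
  fixes \<mu> :: "nat \<Rightarrow> 'a::euclidean_space measure"
  assumes prob: "\<And>n. prob_space (\<mu> n)" and sets: "\<And>n. sets (\<mu> n) = sets borel"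
    and K: "compact K" and carried: "\<And>n. AE x in \<mu> n. x \<in> K"
  obtains r M where "strict_mono (r :: nat \<Rightarrow> nat)" "prob_space M" "sets M = sets borel"
    "AE x in M. x \<in> K"
    "\<And>g :: 'a \<Rightarrow> real. continuous_on UNIV g \<Longrightarrow>
       (\<lambda>n. integral\<^sup>L (\<mu> (r n)) g) \<longlonglongrightarrow> integral\<^sup>L M g"
proof -
  obtain f :: "real \<Rightarrow> 'a" and \<sigma> :: "'a \<Rightarrow> real" where f: "continuous_on UNIV f" "bounded (range f)"
    and \<sigma>: "\<sigma> \<in> borel_measurable borel" "\<And>x. 0 \<le> \<sigma> x" "\<And>x. \<sigma> x \<le> 1"
    and f\<sigma>: "\<And>x. x \<in> K \<Longrightarrow> f (\<sigma> x) = x"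
    using space_filling_curve_with_measurable_section[OF compact_imp_bounded[OF K]] by metis
  have fm: "f \<in> borel_measurable borel"
    using f(1) by (rule borel_measurable_continuous_onI)
  have \<sigma>m: "\<sigma> \<in> measurable (\<mu> n) borel" for n
    using \<sigma>(1) sets by (simp cong: measurable_cong_sets)
  define \<nu> where "\<nu> n = distr (\<mu> n) borel \<sigma>" for n
  have rd: "real_distribution (\<nu> n)" for n
    unfolding \<nu>_def using prob_space.prob_space_distr[OF prob \<sigma>m]
    by (intro real_distribution.intro real_distribution_axioms.intro) auto
  \<comment> \<open>Tightness is phrased with half-open intervals; the left end -1 keeps the
    possible value 0 of \<sigma> inside.\<close>
  have \<nu>1: "measure (\<nu> n) {-1<..1} = 1" for n
  proof -
    have "\<sigma> -` {-1<..1} = UNIV"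
      using \<sigma>(2,3) by (force simp: greaterThanAtMost_def intro: less_le_trans[of _ 0])
    then have "measure (\<nu> n) {-1<..1} = measure (\<mu> n) (space (\<mu> n))"
      unfolding \<nu>_def by (subst measure_distr[OF \<sigma>m]) auto
    then show ?thesis
      by (simp add: prob_space.prob_space[OF prob])
  qed
  have "\<exists>a b. a < b \<and> (\<forall>n. measure (\<nu> n) {a<..b} > 1 - \<epsilon>)" if "\<epsilon> > 0" for \<epsilon>
    by (rule exI[of _ "-1"], rule exI[of _ 1]) (simp add: that \<nu>1)
  then have "tight \<nu>"
    unfolding tight_def using rd by blast
  then obtain r M where r: "strict_mono (r :: nat \<Rightarrow> nat)" and M: "real_distribution M"
    and wc: "weak_conv_m (\<nu> \<circ> r) M"
    using tight_imp_convergent_subsubsequence[of \<nu> id] by (auto simp: strict_mono_id)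
  define L where "L = distr M borel f"
  have fM: "f \<in> measurable M borel"
    using fm M by (simp add: real_distribution.events_eq_borel cong: measurable_cong_sets)
  have conv: "(\<lambda>n. integral\<^sup>L (\<mu> (r n)) g) \<longlonglongrightarrow> integral\<^sup>L L g"
    if g: "continuous_on UNIV g" for g :: "'a \<Rightarrow> real"
  proof -
    have gm: "g \<in> borel_measurable borel"
      using g by (rule borel_measurable_continuous_onI)
    \<comment> \<open>\<open>g\<close> may be unbounded, but weak convergence on the line only sees
      its values on the bounded curve \<open>f\<close>.\<close>
    have "compact (g ` closure (range f))"
      using f(2) by (intro compact_continuous_image continuous_on_subset[OF g]) (auto simp: compact_closure)
    then obtain B where "\<forall>y\<in>g ` closure (range f). norm y \<le> B"
      by (meson bounded_iff compact_imp_bounded)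
    then have B: "norm (g (f t)) \<le> B" for t
      using closure_subset[of "range f"] by blast
    have "isCont (\<lambda>t. g (f t)) t" for t
      using continuous_on_compose2[OF g f(1)] by (simp add: continuous_on_eq_continuous_at)
    then have "(\<lambda>n. integral\<^sup>L ((\<nu> \<circ> r) n) (\<lambda>t. g (f t))) \<longlonglongrightarrow> integral\<^sup>L M (\<lambda>t. g (f t))"
      by (intro weak_conv_imp_integral_bdd_continuous_conv[of "\<nu> \<circ> r" M "\<lambda>t. g (f t)" B]) (use B rd M wc in auto)
    moreover have "integral\<^sup>L ((\<nu> \<circ> r) n) (\<lambda>t. g (f t)) = integral\<^sup>L (\<mu> (r n)) g" for n
    proof -
      have "integral\<^sup>L ((\<nu> \<circ> r) n) (\<lambda>t. g (f t)) = integral\<^sup>L (\<mu> (r n)) (\<lambda>x. g (f (\<sigma> x)))"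
        unfolding \<nu>_def o_def by (rule integral_distr[OF \<sigma>m]) (use fm gm in measurable)
      also have "\<dots> = integral\<^sup>L (\<mu> (r n)) g"
      proof (rule integral_cong_AE)
        show "(\<lambda>x. g (f (\<sigma> x))) \<in> borel_measurable (\<mu> (r n))"
          by (rule measurable_compose[OF \<sigma>m]) (use fm gm in measurable)
        show "g \<in> borel_measurable (\<mu> (r n))"
          using gm sets by (simp cong: measurable_cong_sets)
        show "AE x in \<mu> (r n). g (f (\<sigma> x)) = g x"
          using carried[of "r n"] by eventually_elim (simp add: f\<sigma>)
      qed
      finally show ?thesis .
    qed
    moreover have "integral\<^sup>L L g = integral\<^sup>L M (\<lambda>t. g (f t))"
      unfolding L_def by (rule integral_distr[OF fM gm])
    ultimately show ?thesis by simp
  qed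
  have Lp: "prob_space L"
    unfolding L_def using prob_space.prob_space_distr[OF _ fM] M by (simp add: real_distribution_def)
  have Ls: "sets L = sets borel"
    by (simp add: L_def)
  \<comment> \<open>A test function whose zero set is \<open>K\<close>, capped at 1 so that it is
    integrable before the limit is known to be carried by \<open>K\<close>.\<close>
  define h where "h x = min 1 (infdist x K)" for x
  have hc: "continuous_on UNIV h"
    unfolding h_def by (intro continuous_intros)
  \<comment> \<open>\<open>infdist\<close> to the empty set is 0 by convention, so its vanishing
    characterises membership only for non-empty \<open>K\<close>.\<close>
  have "K \<noteq> {}"
    using carried[of 0] prob_space.AE_False[OF prob] by auto
  have "integral\<^sup>L (\<mu> (r n)) h = 0" for n
    using carried[of "r n"] \<open>K \<noteq> {}\<close> by (intro integral_eq_zero_AE) (auto simp: h_def elim!: eventually_mono)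
  then have "integral\<^sup>L L h = 0"
    using conv[OF hc] by (simp add: LIMSEQ_const_iff)
  moreover have "integrable L h"
  proof (rule finite_measure.integrable_const_bound[where B = 1])
    show "finite_measure L" using Lp by (rule prob_space.finite_measure)
    show "AE x in L. norm (h x) \<le> 1" by (auto simp: h_def infdist_nonneg)
    show "h \<in> borel_measurable L"
      using borel_measurable_continuous_onI[OF hc] Ls by (simp cong: measurable_cong_sets)
  qed
  ultimately have "AE x in L. h x = 0"
    by (subst (asm) integral_nonneg_eq_0_iff_AE) (auto simp: h_def infdist_nonneg)
  then have "AE x in L. x \<in> K"
  proof eventually_elim
    case (elim x)
    then have "infdist x K = 0"
      by (simp add: h_def min_def split: if_splits)
    then show ?case
      using in_closed_iff_infdist_zero[OF compact_imp_closed[OF K] \<open>K \<noteq> {}\<close>] by blast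
  qed
  then show thesis
    using that[OF r Lp Ls _ conv] by blast
qed

section \<open>Test functions\<close>

text \<open>Lets C1 functions be built from any convenient family of derivatives, without computing
  \<open>frechet_derivative\<close> at each step.\<close>

lemma Ck_on_1_iff:
  "Ck_on 1 UNIV f \<longleftrightarrow>
    (\<exists>f'. (\<forall>x. (f has_derivative f' x) (at x)) \<and> (\<forall>v. continuous_on UNIV (\<lambda>x. f' x v)))"
proof
  assume "Ck_on 1 UNIV f"
  then show "\<exists>f'. (\<forall>x. (f has_derivative f' x) (at x)) \<and> (\<forall>v. continuous_on UNIV (\<lambda>x. f' x v))"
    by (intro exI[of _ "\<lambda>x. frechet_derivative f (at x)"]) (simp add: frechet_derivative_works[symmetric])
next
  assume "\<exists>f'. (\<forall>x. (f has_derivative f' x) (at x)) \<and> (\<forall>v. continuous_on UNIV (\<lambda>x. f' x v))"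
  then obtain f' where f': "\<And>x. (f has_derivative f' x) (at x)" "\<And>v. continuous_on UNIV (\<lambda>x. f' x v)"
    by auto
  then have "frechet_derivative f (at x) = f' x" for x
    by (metis frechet_derivative_at)
  then show "Ck_on 1 UNIV f"
    using f' by (auto simp: differentiable_def)
qed

lemma Ck_on_1_continuous: "Ck_on 1 UNIV f \<Longrightarrow> continuous_on UNIV f"
  unfolding Ck_on_1_iff by (meson continuous_at_imp_continuous_on has_derivative_continuous)

lemma Ck_on_1_const: "Ck_on 1 UNIV (\<lambda>x. c)"
  unfolding Ck_on_1_iff by (auto intro!: exI[of _ "\<lambda>x v. 0"])

lemma Ck_on_1_add:
  assumes "Ck_on 1 UNIV f" "Ck_on 1 UNIV g"
  shows "Ck_on 1 UNIV (\<lambda>x. f x + g x)"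
proof -
  obtain f' g' where "\<And>x. (f has_derivative f' x) (at x)" "\<And>v. continuous_on UNIV (\<lambda>x. f' x v)"
    "\<And>x. (g has_derivative g' x) (at x)" "\<And>v. continuous_on UNIV (\<lambda>x. g' x v)"
    using assms unfolding Ck_on_1_iff by metis
  then show ?thesis
    unfolding Ck_on_1_iff
    by (intro exI[of _ "\<lambda>x v. f' x v + g' x v"]) (auto intro!: derivative_intros continuous_intros)
qed

lemma Ck_on_1_mult:
  fixes f g :: "'a::euclidean_space \<Rightarrow> real"
  assumes "Ck_on 1 UNIV f" "Ck_on 1 UNIV g"
  shows "Ck_on 1 UNIV (\<lambda>x. f x * g x)"
proof -
  obtain f' g' where "\<And>x. (f has_derivative f' x) (at x)" "\<And>v. continuous_on UNIV (\<lambda>x. f' x v)"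
    "\<And>x. (g has_derivative g' x) (at x)" "\<And>v. continuous_on UNIV (\<lambda>x. g' x v)"
    using assms unfolding Ck_on_1_iff by metis
  then show ?thesis
    unfolding Ck_on_1_iff
    using assms[THEN Ck_on_1_continuous]
    by (intro exI[of _ "\<lambda>x v. f x * g' x v + f' x v * g x"]) (auto intro!: derivative_intros continuous_intros)
qed

lemma Ck_on_1_prod:
  fixes f :: "'i \<Rightarrow> 'a::euclidean_space \<Rightarrow> real"
  assumes "\<And>i. i \<in> I \<Longrightarrow> Ck_on 1 UNIV (f i)"
  shows "Ck_on 1 UNIV (\<lambda>x. \<Prod>i\<in>I. f i x)"
  using assms
  by (induction I rule: infinite_finite_induct) (auto intro!: Ck_on_1_const Ck_on_1_mult simp del: Ck_on.simps One_nat_def)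

lemma Ck_on_1_inverse:
  fixes f :: "'a::euclidean_space \<Rightarrow> real"
  assumes "Ck_on 1 UNIV f" "\<And>x. f x \<noteq> 0"
  shows "Ck_on 1 UNIV (\<lambda>x. inverse (f x))"
proof -
  obtain f' where "\<And>x. (f has_derivative f' x) (at x)" "\<And>v. continuous_on UNIV (\<lambda>x. f' x v)"
    using assms unfolding Ck_on_1_iff by metis
  then show ?thesis
    unfolding Ck_on_1_iff
    using assms Ck_on_1_continuous[OF assms(1)]
    by (intro exI[of _ "\<lambda>x v. - (inverse (f x) * f' x v * inverse (f x))"])
      (auto intro!: derivative_intros continuous_intros)
qed

text \<open>Squaring removes the corner: at 0 the difference quotient is bounded by
  \<open>\<bar>h\<bar>\<close>. This gives C1 functions that are positive exactly on an open
  half-space.\<close>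

lemma has_derivative_max_zero_squared:
  "((\<lambda>t::real. (max 0 t)\<^sup>2) has_real_derivative (2 * max 0 t)) (at t)"
proof -
  consider "t > 0" | "t < 0" | "t = 0" by linarith
  then show ?thesis
  proof cases
    case 1
    have "((\<lambda>t::real. t\<^sup>2) has_real_derivative (2 * t)) (at t)"
      by (auto intro!: derivative_eq_intros)
    then have "((\<lambda>t::real. (max 0 t)\<^sup>2) has_real_derivative (2 * t)) (at t)"
      by (rule has_field_derivative_transform_within_open[of _ _ _ "{0<..}"]) (use 1 in auto)
    then show ?thesis using 1 by simp
  next
    case 2
    have "((\<lambda>t::real. 0) has_real_derivative 0) (at t)"
      by simp
    then have "((\<lambda>t::real. (max 0 t)\<^sup>2) has_real_derivative 0) (at t)"
      by (rule has_field_derivative_transform_within_open[of _ _ _ "{..<0}"]) (use 2 in auto)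
    then show ?thesis using 2 by simp
  next
    case 3
    have "((\<lambda>h::real. (max 0 h)\<^sup>2 / h) \<longlongrightarrow> 0) (at 0)"
    proof (rule Lim_null_comparison)
      show "\<forall>\<^sub>F h in at 0. norm ((max 0 h)\<^sup>2 / h) \<le> \<bar>h::real\<bar>"
        by (auto simp: max_def power2_eq_square)
      show "((\<lambda>h::real. \<bar>h\<bar>) \<longlongrightarrow> 0) (at 0)"
        by (rule tendsto_rabs_zero) (rule tendsto_ident_at)
    qed
    then show ?thesis using 3 by (simp add: has_field_derivative_iff)
  qed
qed

lemma Ck_on_1_max_zero_squared:
  fixes l :: "'a::euclidean_space \<Rightarrow> real"
  assumes "Ck_on 1 UNIV l"
  shows "Ck_on 1 UNIV (\<lambda>x. (max 0 (l x))\<^sup>2)"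
proof -
  obtain l' where l': "\<And>x. (l has_derivative l' x) (at x)" "\<And>v. continuous_on UNIV (\<lambda>x. l' x v)"
    using assms unfolding Ck_on_1_iff by metis
  have "((\<lambda>x. (max 0 (l x))\<^sup>2) has_derivative (\<lambda>v. 2 * max 0 (l x) * l' x v)) (at x)" for x
    using has_derivative_compose[OF l'(1) has_derivative_max_zero_squared[unfolded has_field_derivative_def]] .
  moreover have "continuous_on UNIV (\<lambda>x. 2 * max 0 (l x) * l' x v)" for v
    by (intro continuous_intros l' Ck_on_1_continuous assms)
  ultimately show ?thesis
    unfolding Ck_on_1_iff by (intro exI[of _ "\<lambda>x v. 2 * max 0 (l x) * l' x v"]) auto
qed

section \<open>Compactly supported C1 functions determine integrable densities\<close>

lemma Ck_on_1_inner_left: "Ck_on 1 UNIV (\<lambda>x::'a::euclidean_space. c * (x \<bullet> b))"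
  unfolding Ck_on_1_iff
  by (intro exI[of _ "\<lambda>x v. c * (v \<bullet> b)"]) (auto intro!: derivative_eq_intros)

text \<open>With \<open>w\<close> a C1 function positive exactly on the box, the quotients
  \<open>w / (w + 1/(n+1))\<close> stay in [0, 1], vanish off the box and tend to 1 wherever
  \<open>w\<close> is positive.\<close>

lemma C1_approximation_of_box_indicator:
  fixes a b :: "'a::euclidean_space"
  obtains f :: "nat \<Rightarrow> 'a \<Rightarrow> real" where
    "\<And>n. Ck_on 1 UNIV (f n)" "\<And>n. compact (closure {x. f n x \<noteq> 0})" "\<And>n x. \<bar>f n x\<bar> \<le> 1"
    "\<And>x. (\<lambda>n. f n x) \<longlonglongrightarrow> indicator (box a b) x"
proof -
  \<comment> \<open>The factors 1 and -1 and the added constants put both affine functions into the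
    shape of \<open>Ck_on_1_inner_left\<close> and \<open>Ck_on_1_add\<close>.\<close>
  define w where
    "w x = (\<Prod>i\<in>Basis. (max 0 (1 * (x \<bullet> i) + - (a \<bullet> i)))\<^sup>2 * (max 0 (- 1 * (x \<bullet> i) + b \<bullet> i))\<^sup>2)" for x
  define f where "f n x = w x * inverse (w x + 1 / real (Suc n))" for n x
  have w0: "w x \<ge> 0" for x
    unfolding w_def by (intro prod_nonneg) auto
  have wpos: "w x > 0" if "x \<in> box a b" for x
    using that unfolding w_def by (intro prod_pos) (auto simp: box_def)
  have wzero: "w x = 0" if "x \<notin> box a b" for x
  proof -
    obtain i where "i \<in> Basis" "x \<bullet> i \<le> a \<bullet> i \<or> b \<bullet> i \<le> x \<bullet> i"
      using \<open>x \<notin> box a b\<close> by (auto simp: box_def not_less)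
    then show ?thesis
      unfolding w_def by (intro prod_zero) (auto intro!: bexI[of _ i])
  qed
  have wC1: "Ck_on 1 UNIV w"
    unfolding w_def
    by (intro Ck_on_1_prod Ck_on_1_mult Ck_on_1_max_zero_squared Ck_on_1_add Ck_on_1_inner_left Ck_on_1_const)
  have pos: "w x + 1 / real (Suc n) > 0" for x n
    using w0[of x] by (intro add_nonneg_pos) auto
  show thesis
  proof (rule that[of f])
    show "Ck_on 1 UNIV (f n)" for n
      unfolding f_def
      by (intro Ck_on_1_mult Ck_on_1_inverse Ck_on_1_add wC1 Ck_on_1_const) (use pos in \<open>auto simp: less_imp_neq[symmetric]\<close>)
    show "compact (closure {x. f n x \<noteq> 0})" for n
    proof -
      have "{x. f n x \<noteq> 0} \<subseteq> cbox a b"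
        using wzero box_subset_cbox[of a b] by (auto simp: f_def)
      then show ?thesis
        by (meson bounded_cbox bounded_subset compact_closure)
    qed
    show "\<bar>f n x\<bar> \<le> 1" for n x
      using w0[of x] pos[of x n] by (simp add: f_def field_simps abs_mult)
    show "(\<lambda>n. f n x) \<longlonglongrightarrow> indicator (box a b) x" for x
    proof (cases "x \<in> box a b")
      case True
      have "(\<lambda>n. w x * inverse (w x + 1 / real (Suc n))) \<longlonglongrightarrow> w x * inverse (w x + 0)"
        using wpos[OF True] LIMSEQ_inverse_real_of_nat
        by (intro tendsto_intros) (auto simp: inverse_eq_divide)
      then show ?thesis
        using True wpos[OF True] by (simp add: f_def)
    qed (simp add: f_def wzero)
  qed
qed

text \<open>The fundamental lemma of the calculus of variations for a Borel measure. Dominated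
  convergence passes from test functions to open boxes, an intersection-stable generator of the
  Borel sets; Dynkin's argument reaches all Borel sets, on which \<open>g\<close> then has the same
  integrals as 0.\<close>

lemma AE_zero_if_integral_C1c_zero:
  fixes V :: "'a::euclidean_space measure" and g :: "'a \<Rightarrow> real"
  assumes sets: "sets V = sets borel" and g: "integrable V g"
    and zero: "\<And>\<psi>. Ck_on 1 UNIV \<psi> \<Longrightarrow> compact (closure {x. \<psi> x \<noteq> 0}) \<Longrightarrow> (\<integral>x. \<psi> x * g x \<partial>V) = 0"
  shows "AE x in V. g x = 0"
proof -
  have [measurable]: "g \<in> borel_measurable V"
    using g by simp
  have sp: "space V = UNIV"
    using sets_eq_imp_space_eq[OF sets] by simp
  have box: "(\<integral>x. indicator (box a b) x * g x \<partial>V) = 0" for a b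
  proof -
    obtain f :: "nat \<Rightarrow> 'a \<Rightarrow> real" where f: "\<And>n. Ck_on 1 UNIV (f n)"
      "\<And>n. compact (closure {x. f n x \<noteq> 0})" "\<And>n x. \<bar>f n x\<bar> \<le> 1"
      "\<And>x. (\<lambda>n. f n x) \<longlonglongrightarrow> indicator (box a b) x"
      using C1_approximation_of_box_indicator[of a b] by metis
    have fm: "f n \<in> borel_measurable V" for n
      using borel_measurable_continuous_onI[OF Ck_on_1_continuous[OF f(1)]] sets
      by (simp cong: measurable_cong_sets)
    have "(\<lambda>n. \<integral>x. f n x * g x \<partial>V) \<longlonglongrightarrow> (\<integral>x. indicator (box a b) x * g x \<partial>V)"
    proof (rule integral_dominated_convergence[where w = "\<lambda>x. \<bar>g x\<bar>"])
      show "(\<lambda>x. indicator (box a b) x * g x) \<in> borel_measurable V"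
        by (intro borel_measurable_times borel_measurable_indicator) (auto simp: sets)
      show "(\<lambda>x. f n x * g x) \<in> borel_measurable V" for n
        using fm by measurable
      show "AE x in V. (\<lambda>n. f n x * g x) \<longlonglongrightarrow> indicator (box a b) x * g x"
        by (intro always_eventually allI tendsto_intros f)
      show "AE x in V. norm (f n x * g x) \<le> \<bar>g x\<bar>" for n
        using f(3) by (auto simp: abs_mult intro!: mult_left_le_one_le)
    qed (use g in auto)
    then show ?thesis
      using zero[OF f(1,2)] by (simp add: LIMSEQ_const_iff)
  qed
  \<comment> \<open>The complement case of Dynkin's argument needs the integral over the whole
    space, which is exhausted by growing cubes.\<close>
  have all: "(\<integral>x. g x \<partial>V) = 0"
  proof -
    define a where "a n = - (real n *\<^sub>R (One::'a))" for n
    have "(\<lambda>n. \<integral>x. indicator (box (a n) (- a n)) x * g x \<partial>V) \<longlonglongrightarrow> (\<integral>x. g x \<partial>V)"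
    proof (rule integral_dominated_convergence[where w = "\<lambda>x. \<bar>g x\<bar>"])
      show "AE x in V. (\<lambda>n. indicator (box (a n) (- a n)) x * g x) \<longlonglongrightarrow> g x"
      proof (rule AE_I2, rule tendsto_eventually)
        fix x :: 'a
        obtain n0 :: nat where n0: "norm x < real n0"
          using reals_Archimedean2 by blast
        show "\<forall>\<^sub>F n in sequentially. indicator (box (a n) (- a n)) x * g x = g x"
        proof (rule eventually_sequentiallyI[of n0])
          fix n assume "n0 \<le> n"
          then have "norm x < real n" using n0 by simp
          then have "\<bar>x \<bullet> i\<bar> < real n" if "i \<in> Basis" for i
            using Basis_le_norm[OF that, of x] by linarith
          then have "x \<in> box (a n) (- a n)"
            by (auto simp: a_def box_def abs_less_iff minus_less_iff)
          then show "indicator (box (a n) (- a n)) x * g x = g x" by simp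
        qed
      qed
      show "(\<lambda>x. indicator (box (a n) (- a n)) x * g x) \<in> borel_measurable V" for n
        by (intro borel_measurable_times borel_measurable_indicator) (auto simp: sets)
      show "AE x in V. norm (indicator (box (a n) (- a n)) x * g x) \<le> \<bar>g x\<bar>" for n
        by (auto simp: indicator_def)
    qed (use g in auto)
    then show ?thesis
      using box by (simp add: LIMSEQ_const_iff)
  qed
  have int: "integrable V (\<lambda>x. indicator A x * g x)" if "A \<in> sets borel" for A
    using integrable_real_mult_indicator[of A V g] that g sets by (simp add: mult.commute)
  have all_sets: "(\<integral>x. indicator A x * g x \<partial>V) = 0" if A: "A \<in> sets borel" for A
  proof -
    let ?G = "range (\<lambda>(a, b). box a b :: 'a set)"
    have "Int_stable ?G"
      by (auto simp: Int_stable_def box_Int_box)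
    moreover have "?G \<subseteq> Pow UNIV"
      by auto
    moreover have "A \<in> sigma_sets UNIV ?G"
      using A by (subst (asm) borel_eq_box) simp
    ultimately show ?thesis
    proof (induction rule: sigma_sets_induct_disjoint)
      case (compl A)
      then have "A \<in> sets borel" by (subst borel_eq_box) simp
      then have "(\<integral>x. g x - indicator A x * g x \<partial>V) = 0"
        using compl.IH all by (subst Bochner_Integration.integral_diff) (auto intro: g int)
      moreover have "indicator (UNIV - A) x * g x = g x - indicator A x * g x" for x
        by (auto simp: indicator_def)
      ultimately show ?case by simp
    next
      case (union A)
      then have A: "A n \<in> sets borel" for n by (subst borel_eq_box) auto
      from union have dj: "disjoint_family A" by blast
      have "(\<integral>x\<in>(\<Union>n. A n). g x \<partial>V) = (\<Sum>n. \<integral>x\<in>A n. g x \<partial>V)"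
      proof (rule lebesgue_integral_countable_add)
        show "A i \<inter> A j = {}" if "i \<noteq> j" for i j
          using dj that by (auto simp: disjoint_family_on_def)
        show "set_integrable V (\<Union>n. A n) g"
          unfolding set_integrable_def using int[of "\<Union>n. A n"] A by auto
      qed (use A sets in auto)
      then show ?case
        using union.IH by (simp add: set_lebesgue_integral_def)
    qed (use box in auto)
  qed
  have "AE x in V. g x = (\<lambda>_. 0) x"
    by (rule density_unique_real[OF g])
      (use all_sets sets in \<open>auto simp: set_lebesgue_integral_def\<close>)
  then show ?thesis by simp
qed

section \<open>The Grassmann bundle\<close>

text \<open>\<open>A\<close> fixes its range, so a non-zero \<open>u\<close> in the range of
  \<open>A\<close> with \<open>B *v u = 0\<close> would be fixed by \<open>A - B\<close>, against
  the norm bound. Hence \<open>B\<close> is injective on the range of \<open>A\<close>.\<close>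

lemma rank_le_if_close_idempotent:
  fixes A B :: "real^'s^'s"
  assumes A: "A ** A = A" and close: "onorm ((*v) (A - B)) < 1"
  shows "rank A \<le> rank B"
proof -
  have inj: "inj_on ((*v) B) (range ((*v) A))"
  proof (rule inj_onI)
    fix u v assume "u \<in> range ((*v) A)" "v \<in> range ((*v) A)" and eq: "B *v u = B *v v"
    then have "A *v u = u" "A *v v = v"
      using A by (auto simp: matrix_vector_mul_assoc)
    then have "(A - B) *v (u - v) = u - v"
      using eq by (simp add: matrix_vector_mult_diff_rdistrib matrix_vector_mult_diff_distrib)
    then have le: "norm (u - v) \<le> onorm ((*v) (A - B)) * norm (u - v)"
      using onorm[OF matrix_vector_mul_bounded_linear, of "A - B" "u - v"] by simp
    show "u = v"
    proof (rule ccontr)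
      assume "u \<noteq> v"
      then have "onorm ((*v) (A - B)) * norm (u - v) < 1 * norm (u - v)"
        by (intro mult_strict_right_mono close) simp
      then show False using le by simp
    qed
  qed
  have "span (range ((*v) A)) = range ((*v) A)"
    unfolding span_eq_iff by (rule linear_subspace_image[OF matrix_vector_mul_linear subspace_UNIV])
  then have "rank A = dim ((*v) B ` range ((*v) A))"
    unfolding rank_dim_range
    using dim_image_eq[OF matrix_vector_mul_linear, of B "range ((*v) A)"] inj by (simp only:)
  also have "\<dots> \<le> rank B"
    unfolding rank_dim_range by (rule dim_subset) auto
  finally show ?thesis .
qed

lemma tendsto_matrix_nth:
  fixes X :: "'b \<Rightarrow> real^'n^'m"
  assumes "(X \<longlongrightarrow> L) F" shows "((\<lambda>k. X k $ i $ j) \<longlongrightarrow> L $ i $ j) F"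
  by (intro tendsto_vec_nth assms)

text \<open>Symmetry and idempotence make \<open>P $ j $ j\<close> the sum of the squares of column
  \<open>j\<close>. It therefore dominates its own square, so it is at most 1, and it dominates the
  square of each entry of the column.\<close>

lemma Grass_entry_bound:
  assumes "P \<in> Grass m" shows "\<bar>P $ i $ j\<bar> \<le> 1"
proof -
  have sym: "P $ k $ l = P $ l $ k" for k l
    using assms unfolding Grass_def transpose_def vec_eq_iff by simp
  have "P $ j $ j = (\<Sum>k\<in>UNIV. P $ j $ k * P $ k $ j)"
    using assms unfolding Grass_def matrix_matrix_mult_def vec_eq_iff by simp
  also have "\<dots> = (\<Sum>k\<in>UNIV. (P $ k $ j)\<^sup>2)"
    by (simp add: sym[of j] power2_eq_square)
  finally have diag: "P $ j $ j = (\<Sum>k\<in>UNIV. (P $ k $ j)\<^sup>2)" .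
  have le: "(P $ k $ j)\<^sup>2 \<le> P $ j $ j" for k
    unfolding diag by (rule member_le_sum) auto
  have "P $ j $ j \<le> 1"
  proof (rule ccontr)
    assume "\<not> P $ j $ j \<le> 1"
    then have "1 * P $ j $ j < P $ j $ j * P $ j $ j"
      by (intro mult_strict_right_mono) auto
    then show False using le[of j] by (simp add: power2_eq_square)
  qed
  then have "(P $ i $ j)\<^sup>2 \<le> 1" using le[of i] by linarith
  then show ?thesis by (simp add: abs_square_le_1)
qed

lemma norm_matrix_le_sum: "norm (A :: real^'n^'m) \<le> (\<Sum>i\<in>UNIV. \<Sum>j\<in>UNIV. \<bar>A $ i $ j\<bar>)"
proof -
  have "norm A \<le> (\<Sum>i\<in>UNIV. norm (A $ i))"
    unfolding norm_vec_def by (rule L2_set_le_sum) simp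
  also have "\<dots> \<le> (\<Sum>i\<in>UNIV. \<Sum>j\<in>UNIV. \<bar>A $ i $ j\<bar>)"
    by (intro sum_mono norm_le_l1_cart)
  finally show ?thesis .
qed

text \<open>Symmetry and idempotence are polynomial equations and pass to limits. Rank is not
  continuous on matrices, but both \<open>X n\<close> and its limit are idempotent, so once they are
  close \<open>rank_le_if_close_idempotent\<close> applies in both directions.\<close>

lemma compact_Grass: "compact (Grass m :: (real^'s^'s) set)"
  unfolding compact_eq_bounded_closed
proof
  have "norm P \<le> (\<Sum>i\<in>(UNIV::'s set). \<Sum>j\<in>(UNIV::'s set). 1)" if "P \<in> Grass m" for P :: "real^'s^'s"
    using norm_matrix_le_sum[of P] Grass_entry_bound[OF that]
    by (meson order_trans sum_mono)
  then show "bounded (Grass m :: (real^'s^'s) set)"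
    unfolding bounded_iff by blast
  show "closed (Grass m :: (real^'s^'s) set)"
    unfolding closed_sequential_limits
  proof (intro allI impI, elim conjE)
    fix X and P :: "real^'s^'s"
    assume X: "\<forall>n. X n \<in> Grass m" and lim: "X \<longlonglongrightarrow> P"
    note l = tendsto_matrix_nth[OF lim]
    have "P $ j $ i = P $ i $ j" for i j
    proof (rule LIMSEQ_unique[OF l])
      have "X n $ j $ i = X n $ i $ j" for n
        using X unfolding Grass_def transpose_def vec_eq_iff by simp
      then show "(\<lambda>n. X n $ j $ i) \<longlonglongrightarrow> P $ i $ j" using l by simp
    qed
    then have sym: "transpose P = P" by (simp add: transpose_def vec_eq_iff)
    have "(\<Sum>k\<in>UNIV. P $ i $ k * P $ k $ j) = P $ i $ j" for i j
    proof (rule LIMSEQ_unique)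
      have "(\<Sum>k\<in>UNIV. X n $ i $ k * X n $ k $ j) = X n $ i $ j" for n
        using X unfolding Grass_def matrix_matrix_mult_def vec_eq_iff by simp
      then show "(\<lambda>n. \<Sum>k\<in>UNIV. X n $ i $ k * X n $ k $ j) \<longlonglongrightarrow> P $ i $ j" using l by simp
      show "(\<lambda>n. \<Sum>k\<in>UNIV. X n $ i $ k * X n $ k $ j) \<longlonglongrightarrow> (\<Sum>k\<in>UNIV. P $ i $ k * P $ k $ j)"
        by (intro tendsto_intros l)
    qed
    then have idem: "P ** P = P" by (simp add: matrix_matrix_mult_def vec_eq_iff)
    have "(\<lambda>n. \<Sum>i\<in>UNIV. \<Sum>j\<in>UNIV. \<bar>(X n - P) $ i $ j\<bar>) \<longlonglongrightarrow> (\<Sum>i\<in>(UNIV::'s set). \<Sum>j\<in>(UNIV::'s set). \<bar>0\<bar>)"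
      by (intro tendsto_intros) (use LIM_zero[OF l] in simp)
    then have "\<forall>\<^sub>F n in sequentially. (\<Sum>i\<in>UNIV. \<Sum>j\<in>UNIV. \<bar>(X n - P) $ i $ j\<bar>) < 1"
      by (rule order_tendstoD) simp
    then obtain n where n: "(\<Sum>i\<in>UNIV. \<Sum>j\<in>UNIV. \<bar>(X n - P) $ i $ j\<bar>) < 1"
      using eventually_happens by force
    then have n': "(\<Sum>i\<in>UNIV. \<Sum>j\<in>UNIV. \<bar>(P - X n) $ i $ j\<bar>) < 1"
      by (simp add: abs_minus_commute)
    have "onorm ((*v) (X n - P)) < 1" "onorm ((*v) (P - X n)) < 1"
      using onorm_le_matrix_component_sum[of "X n - P"] onorm_le_matrix_component_sum[of "P - X n"] n n'
      by linarith+
    moreover have "X n ** X n = X n" "rank (X n) = m"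
      using X by (auto simp: Grass_def)
    ultimately have "rank P = m"
      using rank_le_if_close_idempotent[of "X n" P] rank_le_if_close_idempotent[of P "X n"] idem by simp
    then show "P \<in> Grass m" using sym idem by (simp add: Grass_def)
  qed
qed

lemma is_orth_proj_range_subset_iff:
  fixes P Q :: "real^'s^'s"
  assumes "is_orth_proj T Q"
  shows "range ((*v) P) \<subseteq> T \<longleftrightarrow> Q ** P = P"
proof
  assume "range ((*v) P) \<subseteq> T"
  then have "Q *v (P *v v) = P *v v" for v
    using assms unfolding is_orth_proj_def by (metis (no_types, lifting) imageE matrix_vector_mul_assoc rangeI subsetD)
  then show "Q ** P = P"
    by (simp add: matrix_eq matrix_vector_mul_assoc)
next
  assume "Q ** P = P"
  then have "P *v v = Q *v (P *v v)" for v
    by (simp add: matrix_vector_mul_assoc)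
  then show "range ((*v) P) \<subseteq> T"
    using assms unfolding is_orth_proj_def by (metis image_subsetI rangeI)
qed

text \<open>Replaces tangency, which is defined through curves, by the matrix equation
  \<open>Q x ** P = P\<close>, a closed condition because \<open>Q\<close> is continuous on
  \<open>N\<close>.\<close>

lemma Gm_eq:
  fixes Q :: "real^'s \<Rightarrow> real^'s^'s"
  assumes "N \<subseteq> Nbar" "\<forall>x\<in>Nbar. is_orth_proj (tangent_space Nbar x) (Q x)"
  shows "Gm m Nbar N = {z \<in> N \<times> Grass m. Q (fst z) ** snd z = snd z}"
proof -
  have "range ((*v) P) \<subseteq> tangent_space Nbar x \<longleftrightarrow> Q x ** P = P" if "x \<in> N" for x and P :: "real^'s^'s"
    using that assms by (intro is_orth_proj_range_subset_iff) auto
  then have "z \<in> Gm m Nbar N \<longleftrightarrow> z \<in> {z \<in> N \<times> Grass m. Q (fst z) ** snd z = snd z}" for z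
    by (cases z) (simp add: Gm_def conj_ac cong: conj_cong del: image_subset_iff)
  then show ?thesis by blast
qed

lemma compact_Gm:
  fixes Q :: "real^'s \<Rightarrow> real^'s^'s"
  assumes "N \<subseteq> Nbar" "\<forall>x\<in>Nbar. is_orth_proj (tangent_space Nbar x) (Q x)"
    and N: "compact N" and Q: "continuous_on N Q"
  shows "compact (Gm m Nbar N)"
proof -
  let ?K = "N \<times> (Grass m :: (real^'s^'s) set)"
  let ?h = "\<lambda>i j z. (\<Sum>k\<in>UNIV. Q (fst z) $ i $ k * snd z $ k $ j) - snd z $ i $ j"
  have K: "compact ?K"
    by (intro compact_Times N compact_Grass)
  have "continuous_on ?K (?h i j)" for i j
    by (intro continuous_intros continuous_on_compose2[OF Q]) auto
  then have "closed {z \<in> ?K. ?h i j z = 0}" for i j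
    by (intro continuous_closed_preimage_constant compact_imp_closed K)
  then have "closed (\<Inter>i. \<Inter>j. {z \<in> ?K. ?h i j z = 0})"
    by (intro closed_INT ballI)
  moreover have "Gm m Nbar N = ?K \<inter> (\<Inter>i. \<Inter>j. {z \<in> ?K. ?h i j z = 0})"
    unfolding Gm_eq[OF assms(1,2)] by (auto simp: vec_eq_iff matrix_matrix_mult_def)
  ultimately show ?thesis
    using compact_Int_closed[OF K] by simp
qed

text \<open>Differentiate \<open>Q ** Q = Q\<close> along a curve in \<open>Nbar\<close> with
  velocity \<open>v\<close>. The equation is known on \<open>Nbar\<close> only, which is why
  \<open>v\<close> has to be tangent.\<close>

lemma tangential_derivative_of_projection:
  fixes Q :: "real^'s \<Rightarrow> real^'s^'s"
  assumes proj: "\<forall>x\<in>Nbar. is_orth_proj (tangent_space Nbar x) (Q x)"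
    and D: "(Q has_derivative D) (at x)" and v: "v \<in> tangent_space Nbar x"
  shows "D v = D v ** Q x + Q x ** D v"
proof -
  obtain \<gamma> e where e: "e > 0" and \<gamma>: "\<And>t. t \<in> {-e<..<e} \<Longrightarrow> \<gamma> t \<in> Nbar" "\<gamma> 0 = x"
    and \<gamma>': "(\<gamma> has_vector_derivative v) (at 0)"
    using v unfolding tangent_space_def by blast
  have "((\<lambda>t. Q (\<gamma> t)) has_derivative (\<lambda>h. D (h *\<^sub>R v))) (at 0)"
    using has_derivative_compose[of \<gamma> "\<lambda>h. h *\<^sub>R v" 0 UNIV Q D] \<gamma>' D \<gamma>(2)
    by (simp add: has_vector_derivative_def)
  then have Q': "((\<lambda>t. Q (\<gamma> t) $ i $ j) has_derivative (\<lambda>h. D (h *\<^sub>R v) $ i $ j)) (at 0)" for i j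
    by (intro bounded_linear.has_derivative[OF bounded_linear_vec_nth])
  have lin: "D (h *\<^sub>R v) = h *\<^sub>R D v" for h
    using has_derivative_linear[OF D] by (simp add: linear_cmul)
  have Qd: "((\<lambda>t. Q (\<gamma> t) $ i $ j) has_real_derivative (D v $ i $ j)) (at 0)" for i j
    using Q'[of i j] unfolding has_field_derivative_def lin by (simp add: mult.commute[of "D v $ i $ j"] mult_commute_abs)
  have "D v $ i $ j = (\<Sum>k\<in>UNIV. D v $ i $ k * Q x $ k $ j + Q x $ i $ k * D v $ k $ j)" for i j
  proof (rule DERIV_unique[OF Qd])
    have "((\<lambda>t. \<Sum>k\<in>UNIV. Q (\<gamma> t) $ i $ k * Q (\<gamma> t) $ k $ j) has_real_derivative
        (\<Sum>k\<in>UNIV. D v $ i $ k * Q x $ k $ j + Q x $ i $ k * D v $ k $ j)) (at 0)"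
      by (rule derivative_eq_intros Qd refl)+ (simp add: \<gamma>(2) algebra_simps)
    then show "((\<lambda>t. Q (\<gamma> t) $ i $ j) has_real_derivative
        (\<Sum>k\<in>UNIV. D v $ i $ k * Q x $ k $ j + Q x $ i $ k * D v $ k $ j)) (at 0)"
    proof (rule has_field_derivative_transform_within_open[of _ _ _ "{-e<..<e}"])
      fix t assume "t \<in> {-e<..<e}"
      then have "Q (\<gamma> t) ** Q (\<gamma> t) = Q (\<gamma> t)"
        using proj \<gamma>(1) by (auto simp: is_orth_proj_def)
      then show "(\<Sum>k\<in>UNIV. Q (\<gamma> t) $ i $ k * Q (\<gamma> t) $ k $ j) = Q (\<gamma> t) $ i $ j"
        unfolding matrix_matrix_mult_def vec_eq_iff by simp
    qed (use e in auto)
  qed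
  then have "(\<Sum>k\<in>UNIV. D v $ i $ k * Q x $ k $ j) + (\<Sum>k\<in>UNIV. Q x $ i $ k * D v $ k $ j) = D v $ i $ j" for i j
    unfolding sum.distrib[symmetric] by (rule sym)
  then show ?thesis
    by (simp add: vec_eq_iff matrix_matrix_mult_def)
qed

lemma matrix_matrix_mult_add_rdistrib:
  fixes A B C :: "real^'s^'s"
  shows "(A + B) ** C = A ** C + B ** C"
  by (simp add: vec_eq_iff matrix_matrix_mult_def sum.distrib algebra_simps)

text \<open>Multiplying the Leibniz identity by \<open>P\<close> on both sides and absorbing
  \<open>Q\<close> into \<open>P\<close> gives \<open>P ** D ** P\<close> twice on the right, hence
  \<open>P ** D ** P\<close> equals its own double.\<close>

lemma projected_derivative_zero:
  fixes P D Q :: "real^'s^'s"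
  assumes D: "D = D ** Q + Q ** D" and QP: "Q ** P = P" and sym: "transpose Q = Q" "transpose P = P"
  shows "P ** D ** P = 0"
proof -
  have PQ: "P ** Q = P"
    using arg_cong[OF QP, of transpose] by (simp add: matrix_transpose_mul sym)
  have "P ** D ** P = P ** (D ** Q + Q ** D) ** P"
    using D by simp
  also have "\<dots> = P ** D ** (Q ** P) + (P ** Q) ** D ** P"
    by (simp add: matrix_add_ldistrib matrix_matrix_mult_add_rdistrib matrix_mul_assoc)
  also have "\<dots> = P ** D ** P + P ** D ** P"
    by (simp add: QP PQ)
  finally show ?thesis by simp
qed

section \<open>Curvature and second fundamental form\<close>

lemma varifoldD:
  assumes V: "varifold m Nbar N V" and G: "compact (Gm m Nbar N)"
  shows "sets V = sets borel" "finite_measure V" "AE z in V. z \<in> Gm m Nbar N"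
proof -
  show s: "sets V = sets borel" and "finite_measure V"
    using V by (auto simp: varifold_def intro!: finite_measureI)
  have "space V - Gm m Nbar N \<in> sets V"
    using borel_compact[OF G] s by (auto simp: s sets_eq_imp_space_eq[OF s])
  then show "AE z in V. z \<in> Gm m Nbar N"
    using V by (intro AE_I[of _ _ "space V - Gm m Nbar N"]) (auto simp: varifold_def)
qed

lemma integrable_mult_continuous_on_compact:
  fixes f b :: "'a::euclidean_space \<Rightarrow> real"
  assumes "sets V = sets borel" "compact K" "AE z in V. z \<in> K" "continuous_on UNIV b" "integrable V f"
  shows "integrable V (\<lambda>z. f z * b z)"
proof -
  obtain C where C: "\<And>z. z \<in> K \<Longrightarrow> norm (b z) \<le> C"
    using compact_continuous_image[OF continuous_on_subset[OF assms(4)] assms(2)]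
    by (metis bounded_iff compact_imp_bounded image_eqI subset_UNIV)
  have b: "b \<in> borel_measurable V"
    using borel_measurable_continuous_onI[OF assms(4)] assms(1) by (simp cong: measurable_cong_sets)
  show ?thesis
  proof (rule Bochner_Integration.integrable_bound)
    show "integrable V (\<lambda>z. C * f z)" using assms(5) by simp
    show "(\<lambda>z. f z * b z) \<in> borel_measurable V"
      using b assms(5) by measurable
    show "AE z in V. norm (f z * b z) \<le> norm (C * f z)"
      using assms(3)
    proof eventually_elim
      case (elim z)
      have "\<bar>f z\<bar> * \<bar>b z\<bar> \<le> \<bar>f z\<bar> * \<bar>C\<bar>"
        using C[OF elim] by (intro mult_left_mono) auto
      then show ?case by (simp add: abs_mult mult.commute)
    qed
  qed
qed

lemma integrable_continuous_on_compact:
  fixes b :: "'a::euclidean_space \<Rightarrow> real"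
  assumes "sets V = sets borel" "finite_measure V" "compact K" "AE z in V. z \<in> K" "continuous_on UNIV b"
  shows "integrable V b"
proof -
  have "integrable V (\<lambda>z. 1 * b z)"
    using assms finite_measure.integrable_const[OF assms(2)]
    by (intro integrable_mult_continuous_on_compact[of V K]) auto
  then show ?thesis by simp
qed

lemma continuous_on_test_derivatives:
  assumes "C1c \<phi>"
  shows "continuous_on UNIV \<phi>" "continuous_on UNIV (Dx \<phi> j)" "continuous_on UNIV (DP \<phi> j k)"
proof -
  show "continuous_on UNIV \<phi>"
    using assms by (auto simp: C1c_def intro: Ck_on_1_continuous simp del: Ck_on.simps One_nat_def)
  show "continuous_on UNIV (Dx \<phi> j)" "continuous_on UNIV (DP \<phi> j k)"
    using assms by (auto simp: C1c_def Dx_def[abs_def] DP_def[abs_def])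
qed

definition first_variation_integrand ::
    "((real^'s) \<times> (real^'s^'s) \<Rightarrow> real^'s^'s^'s) \<Rightarrow> ((real^'s) \<times> (real^'s^'s) \<Rightarrow> real) \<Rightarrow>
      's \<Rightarrow> (real^'s) \<times> (real^'s^'s) \<Rightarrow> real" where
  "first_variation_integrand B \<phi> i z =
     (\<Sum>j\<in>UNIV. (snd z) $ i $ j * Dx \<phi> j z)
     + (\<Sum>j\<in>UNIV. \<Sum>k\<in>UNIV. B z $ i $ j $ k * DP \<phi> j k z)
     + (\<Sum>j\<in>UNIV. B z $ j $ i $ j) * \<phi> z"

lemma gen_curvature_iff:
  "gen_curvature V B \<longleftrightarrow>
     (\<forall>i j k. integrable V (\<lambda>z. B z $ i $ j $ k)) \<and>
     (\<forall>\<phi> i. C1c \<phi> \<longrightarrow> integral\<^sup>L V (first_variation_integrand B \<phi> i) = 0)"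
  unfolding gen_curvature_def first_variation_integrand_def[abs_def] ..

lemma borel_measurable_first_variation_integrand:
  assumes s: "sets V = sets borel" and B: "\<And>i j k. integrable V (\<lambda>z. B z $ i $ j $ k)" and \<phi>: "C1c \<phi>"
  shows "first_variation_integrand B \<phi> i \<in> borel_measurable V"
proof -
  have m: "g \<in> borel_measurable V" if "continuous_on UNIV g" for g :: "_ \<Rightarrow> real"
    using borel_measurable_continuous_onI[OF that] s by (simp cong: measurable_cong_sets)
  have [measurable]: "(\<lambda>z. snd z $ i $ j) \<in> borel_measurable V" for i j
    by (rule m) (intro continuous_intros)
  have [measurable]: "Dx \<phi> j \<in> borel_measurable V" "DP \<phi> j k \<in> borel_measurable V" "\<phi> \<in> borel_measurable V" for j k
    using continuous_on_test_derivatives[OF \<phi>] by (auto intro: m)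
  have [measurable]: "(\<lambda>z. B z $ i $ j $ k) \<in> borel_measurable V" for i j k
    using B by blast
  show ?thesis
    unfolding first_variation_integrand_def[abs_def] by measurable
qed

lemma matrix_axis_expansion:
  "(X::real^'n^'m) = (\<Sum>j\<in>UNIV. \<Sum>k\<in>UNIV. X $ j $ k *\<^sub>R axis j (axis k 1))"
proof -
  have "(\<Sum>j\<in>UNIV. \<Sum>k\<in>UNIV. X $ j $ k *\<^sub>R (axis j (axis k 1) :: real^'n^'m)) $ a $ b = X $ a $ b" for a b
  proof -
    have "(\<Sum>j\<in>UNIV. \<Sum>k\<in>UNIV. X $ j $ k *\<^sub>R (axis j (axis k 1) :: real^'n^'m)) $ a $ b
        = (\<Sum>j\<in>UNIV. \<Sum>k\<in>UNIV. if k = b then (if j = a then X $ j $ k else 0) else 0)"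
      unfolding sum_component by (intro sum.cong refl) (auto simp: axis_def)
    also have "\<dots> = X $ a $ b"
      by (simp add: sum.delta)
    finally show ?thesis .
  qed
  then show ?thesis by (simp add: vec_eq_iff)
qed

text \<open>Testing with \<open>h(P) \<psi>(x, P)\<close> for a constraint \<open>h\<close> vanishing on the Grassmannian: only the
  \<open>P\<close>-derivative of \<open>h\<close> survives, so \<open>B\<^sub>i\<close> is tangent to the Grassmannian.\<close>

lemma curvature_tangent_to_constraint:
  fixes h :: "real^'s^'s \<Rightarrow> real"
  assumes V: "varifold m Nbar N V" and G: "compact (Gm m Nbar N)" and B: "gen_curvature V B"
    and h': "\<And>P. (h has_derivative h' P) (at P)" "\<And>X. continuous_on UNIV (\<lambda>P. h' P X)"
    and h0: "\<And>P. P \<in> Grass m \<Longrightarrow> h P = 0"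
  shows "AE z in V. h' (snd z) (B z $ i) = 0"
proof (rule AE_zero_if_integral_C1c_zero)
  note VD = varifoldD[OF V G]
  show "sets V = sets borel" by fact
  have expand: "h' P X = (\<Sum>j\<in>UNIV. \<Sum>k\<in>UNIV. X $ j $ k * h' P (axis j (axis k 1)))" for P X
  proof -
    have "linear (h' P)" using h'(1) by (rule has_derivative_linear)
    then have "h' P (\<Sum>j\<in>UNIV. \<Sum>k\<in>UNIV. X $ j $ k *\<^sub>R axis j (axis k 1)) =
        (\<Sum>j\<in>UNIV. \<Sum>k\<in>UNIV. X $ j $ k * h' P (axis j (axis k 1)))"
      by (simp add: linear_sum linear_cmul)
    then show ?thesis
      using matrix_axis_expansion[of X] by simp
  qed
  have int: "\<And>i j k. integrable V (\<lambda>z. B z $ i $ j $ k)"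
    using B by (simp add: gen_curvature_iff)
  have hB: "(\<lambda>z. h' (snd z) (B z $ i)) =
      (\<lambda>z. \<Sum>j\<in>UNIV. \<Sum>k\<in>UNIV. B z $ i $ j $ k * h' (snd z) (axis j (axis k 1)))"
    by (rule ext) (rule expand)
  show hint: "integrable V (\<lambda>z. h' (snd z) (B z $ i))"
    unfolding hB
    by (intro Bochner_Integration.integrable_sum integrable_mult_continuous_on_compact[OF VD(1) G VD(3)] int
        continuous_on_compose2[OF h'(2)] continuous_intros) auto
  fix \<psi> :: "(real^'s) \<times> (real^'s^'s) \<Rightarrow> real"
  assume \<psi>: "Ck_on 1 UNIV \<psi>" "compact (closure {x. \<psi> x \<noteq> 0})"
  obtain \<psi>' where \<psi>': "\<And>x. (\<psi> has_derivative \<psi>' x) (at x)"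
    using \<psi>(1) unfolding Ck_on_1_iff by metis
  define \<phi> where "\<phi> z = h (snd z) * \<psi> z" for z
  have hs: "((\<lambda>z. h (snd z)) has_derivative (\<lambda>v. h' (snd z) (snd v))) (at z)" for z :: "(real^'s) \<times> (real^'s^'s)"
    by (rule has_derivative_compose[OF has_derivative_snd[OF has_derivative_ident] h'(1)])
  have "Ck_on 1 UNIV (\<lambda>z::(real^'s) \<times> (real^'s^'s). h (snd z))"
    unfolding Ck_on_1_iff
    using hs by (intro exI[of _ "\<lambda>z v. h' (snd z) (snd v)"])
      (auto intro!: continuous_on_compose2[OF h'(2)] continuous_intros)
  then have "Ck_on 1 UNIV \<phi>"
    unfolding \<phi>_def using \<psi>(1) by (rule Ck_on_1_mult)
  moreover have "compact (closure {z. \<phi> z \<noteq> 0})"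
  proof -
    have "{z. \<phi> z \<noteq> 0} \<subseteq> closure {x. \<psi> x \<noteq> 0}"
      using closure_subset[of "{x. \<psi> x \<noteq> 0}"] by (auto simp: \<phi>_def)
    then show ?thesis
      using \<psi>(2) by (meson bounded_subset compact_closure compact_imp_bounded)
  qed
  ultimately have C: "C1c \<phi>" by (simp only: C1c_def)
  have D: "frechet_derivative \<phi> (at z) = (\<lambda>v. h (snd z) * \<psi>' z v + h' (snd z) (snd v) * \<psi> z)" for z
    unfolding \<phi>_def by (rule frechet_derivative_at[symmetric]) (intro has_derivative_mult hs \<psi>')
  have "AE z in V. first_variation_integrand B \<phi> i z = \<psi> z * h' (snd z) (B z $ i)"
    using VD(3)
  proof eventually_elim
    case (elim z)
    then have h: "h (snd z) = 0"
      by (intro h0) (auto simp: Gm_def)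
    have "h' (snd z) 0 = 0"
      using h'(1)[THEN has_derivative_linear] by (simp add: linear_0)
    then have 1: "Dx \<phi> j z = 0" for j
      unfolding Dx_def D using h by simp
    have 2: "DP \<phi> j k z = h' (snd z) (axis j (axis k 1)) * \<psi> z" for j k
      unfolding DP_def D using h by simp
    show ?case
      unfolding first_variation_integrand_def 1 2 expand[of _ "B z $ i"]
      by (simp add: \<phi>_def h sum_distrib_left mult_ac)
  qed
  then have "(\<integral>z. \<psi> z * h' (snd z) (B z $ i) \<partial>V) = integral\<^sup>L V (first_variation_integrand B \<phi> i)"
  proof (intro integral_cong_AE)
    show "first_variation_integrand B \<phi> i \<in> borel_measurable V"
      by (rule borel_measurable_first_variation_integrand[OF VD(1) int C])
    have "\<psi> \<in> borel_measurable V"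
      using borel_measurable_continuous_onI[OF Ck_on_1_continuous[OF \<psi>(1)]] VD(1)
      by (simp cong: measurable_cong_sets)
    then show "(\<lambda>z. \<psi> z * h' (snd z) (B z $ i)) \<in> borel_measurable V"
      using hint by measurable
  qed (auto elim: eventually_mono)
  also have "\<dots> = 0"
    using B C by (simp add: gen_curvature_iff)
  finally show "(\<integral>z. \<psi> z * h' (snd z) (B z $ i) \<partial>V) = 0" .
qed

text \<open>The constraints are the entries of the equations for symmetric idempotents; their
  linearisations at \<open>P\<close> are symmetry and the Leibniz rule for
  \<open>B_i\<close>.\<close>

lemma curvature_symmetric_and_derivation:
  fixes V :: "((real^'s) \<times> (real^'s^'s)) measure"
  assumes V: "varifold m Nbar N V" and G: "compact (Gm m Nbar N)" and B: "gen_curvature V B"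
  shows "AE z in V. \<forall>i. transpose (B z $ i) = B z $ i \<and> B z $ i = B z $ i ** snd z + snd z ** B z $ i"
proof -
  have "AE z in V. (B z $ i) $ j $ k - (B z $ i) $ k $ j = 0" for i j k
  proof (rule curvature_tangent_to_constraint[OF V G B, where h = "\<lambda>P. P $ j $ k - P $ k $ j" and h' = "\<lambda>_ X. X $ j $ k - X $ k $ j"])
    show "((\<lambda>P. P $ j $ k - P $ k $ j) has_derivative (\<lambda>X. X $ j $ k - X $ k $ j)) (at P)" for P :: "real^'s^'s"
      by (intro bounded_linear_imp_has_derivative bounded_linear_sub bounded_linear_compose[OF bounded_linear_vec_nth] bounded_linear_vec_nth)
    show "P $ j $ k - P $ k $ j = 0" if "P \<in> Grass m" for P
      using that unfolding Grass_def transpose_def vec_eq_iff by simp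
  qed (intro continuous_intros)
  then have sym: "AE z in V. \<forall>i j k. (B z $ i) $ j $ k - (B z $ i) $ k $ j = 0"
    by (simp add: AE_all_countable)
  have "AE z in V. (\<Sum>l\<in>UNIV. snd z $ j $ l * (B z $ i) $ l $ k + (B z $ i) $ j $ l * snd z $ l $ k) - (B z $ i) $ j $ k = 0" for i j k
  proof (rule curvature_tangent_to_constraint[OF V G B, where h = "\<lambda>P. (\<Sum>l\<in>UNIV. P $ j $ l * P $ l $ k) - P $ j $ k"
        and h' = "\<lambda>P X. (\<Sum>l\<in>UNIV. P $ j $ l * X $ l $ k + X $ j $ l * P $ l $ k) - X $ j $ k"])
    have nth: "((\<lambda>P. P $ a $ b) has_derivative (\<lambda>X. X $ a $ b)) (at P)" for a b and P :: "real^'s^'s"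
      by (intro bounded_linear_imp_has_derivative bounded_linear_compose[OF bounded_linear_vec_nth] bounded_linear_vec_nth)
    show "((\<lambda>P. (\<Sum>l\<in>UNIV. P $ j $ l * P $ l $ k) - P $ j $ k) has_derivative
       (\<lambda>X. (\<Sum>l\<in>UNIV. P $ j $ l * X $ l $ k + X $ j $ l * P $ l $ k) - X $ j $ k)) (at P)" for P :: "real^'s^'s"
      by (intro has_derivative_diff has_derivative_sum has_derivative_mult nth)
    show "(\<Sum>l\<in>UNIV. P $ j $ l * P $ l $ k) - P $ j $ k = 0" if "P \<in> Grass m" for P
      using that unfolding Grass_def matrix_matrix_mult_def vec_eq_iff by simp
  qed (intro continuous_intros)
  then have der: "AE z in V. \<forall>i j k. (\<Sum>l\<in>UNIV. snd z $ j $ l * (B z $ i) $ l $ k + (B z $ i) $ j $ l * snd z $ l $ k) - (B z $ i) $ j $ k = 0"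
    by (simp add: AE_all_countable)
  show ?thesis
    using sym der
  proof eventually_elim
    case (elim z)
    have "transpose (B z $ i) = B z $ i" for i
      using elim(1) by (simp add: transpose_def vec_eq_iff)
    moreover have "B z $ i = B z $ i ** snd z + snd z ** B z $ i" for i
      using elim(2) by (simp add: vec_eq_iff matrix_matrix_mult_def sum.distrib add.commute)
    ultimately show ?case by blast
  qed
qed

text \<open>When \<open>E q\<close> is the partial derivative of \<open>Q\<close> in direction
  \<open>q\<close>, this is the derivative of \<open>Q\<close> along \<open>P e_i\<close>, since
  \<open>P\<close> is symmetric.\<close>

definition plane_derivative ::
    "('s \<Rightarrow> real^'s \<Rightarrow> real^'s^'s) \<Rightarrow> (real^'s) \<times> (real^'s^'s) \<Rightarrow> 's::finite \<Rightarrow> real^'s^'s" where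
  "plane_derivative E z i = (\<Sum>q\<in>UNIV. snd z $ i $ q *\<^sub>R E q (fst z))"

text \<open>This is \<^const>\<open>sff\<close> with the derivatives \<open>\<partial>\<^sub>q Q\<close>, which behave well only near \<open>N\<close>, replaced by
  arbitrary functions \<open>E q\<close>; these will be continuous extensions to the whole space.\<close>

definition normal_curvature ::
    "('s \<Rightarrow> real^'s \<Rightarrow> real^'s^'s) \<Rightarrow> ((real^'s) \<times> (real^'s^'s) \<Rightarrow> real^'s^'s^'s) \<Rightarrow>
      (real^'s) \<times> (real^'s^'s) \<Rightarrow> real^'s^'s^'s" where
  "normal_curvature E B z = (\<chi> i. transpose ((B z $ i - plane_derivative E z i) ** snd z))"

text \<open>A curvature satisfies \<open>B\<^sub>i = M + M\<^sup>T\<close> with \<open>M = B\<^sub>i P\<close>; a vanishing second fundamental form means that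
  \<open>M\<close> is the derivative of \<open>Q\<close> along \<open>P e\<^sub>i\<close> times \<open>P\<close>.\<close>

definition flat_curvature ::
    "('s \<Rightarrow> real^'s \<Rightarrow> real^'s^'s) \<Rightarrow> (real^'s) \<times> (real^'s^'s) \<Rightarrow> real^'s^'s^'s" where
  "flat_curvature E z =
     (\<chi> i. plane_derivative E z i ** snd z + transpose (plane_derivative E z i ** snd z))"

text \<open>Both terms of \<open>sff\<close> carry the factor \<open>P_lj\<close>, so the sum over
  \<open>l\<close> is a matrix product with \<open>P\<close>. The transpose arises because its row
  index is the last index of \<open>sff\<close>.\<close>

lemma sff_eq_normal_curvature:
  "sff Q B z = normal_curvature (\<lambda>q x. frechet_derivative Q (at x) (axis q 1)) B z"
proof -
  have "plane_derivative E z i $ k $ l = (\<Sum>q\<in>UNIV. snd z $ i $ q * E q (fst z) $ k $ l)" for E i k l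
    by (simp add: plane_derivative_def sum_component)
  then show ?thesis
    by (simp add: sff_def normal_curvature_def vec_eq_iff transpose_def matrix_matrix_mult_def
        left_diff_distrib right_diff_distrib sum_subtractf sum_distrib_right sum_distrib_left mult_ac)
qed

text \<open>By symmetry of \<open>B_i\<close> and \<open>P\<close>, the Leibniz rule says that
  \<open>B_i\<close> is \<open>B_i ** P\<close> plus its transpose. The term with \<open>E\<close>
  is subtracted in \<open>normal_curvature\<close> and restored in \<open>flat_curvature\<close>, so
  the formula is exact for every \<open>E\<close>; it isolates the part of \<open>B\<close> that is
  linear in the normal curvature.\<close>

lemma curvature_from_normal_curvature:
  fixes V :: "((real^'s) \<times> (real^'s^'s)) measure"
  assumes V: "varifold m Nbar N V" and G: "compact (Gm m Nbar N)" and B: "gen_curvature V B"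
  shows "AE z in V. \<forall>i j k. B z $ i $ j $ k =
    normal_curvature E B z $ i $ k $ j + normal_curvature E B z $ i $ j $ k + flat_curvature E z $ i $ j $ k"
  using curvature_symmetric_and_derivation[OF V G B] varifoldD(3)[OF V G]
proof eventually_elim
  case (elim z)
  let ?P = "snd z"
  have symP: "transpose ?P = ?P"
    using elim(2) by (auto simp: Gm_def Grass_def)
  have "B z $ i = transpose (normal_curvature E B z $ i) + normal_curvature E B z $ i + flat_curvature E z $ i" for i
  proof -
    have "?P ** B z $ i = transpose (B z $ i ** ?P)"
      using elim(1) symP by (simp add: matrix_transpose_mul)
    then have "B z $ i = B z $ i ** ?P + transpose (B z $ i ** ?P)"
      using elim(1) by metis
    moreover have "B z $ i ** ?P = (B z $ i - plane_derivative E z i) ** ?P + plane_derivative E z i ** ?P"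
      by (simp flip: matrix_matrix_mult_add_rdistrib)
    moreover have "transpose (X + Y) = transpose X + transpose Y" for X Y :: "real^'s^'s"
      by (simp add: transpose_def vec_eq_iff)
    ultimately show ?thesis
      unfolding normal_curvature_def flat_curvature_def by (simp add: add_ac)
  qed
  then show ?case
    by (simp add: vec_eq_iff transpose_def)
qed

text \<open>With \<open>R\<close> the plane derivative, the flat curvature times \<open>P\<close> is
  \<open>R ** P\<close> plus the transpose of \<open>P ** R ** P\<close>, and the latter vanishes by
  assumption. This is what makes the limit curvature flat.\<close>

lemma normal_curvature_flat_curvature:
  assumes idem: "snd z ** snd z = snd z" and sym: "transpose (snd z) = snd z"
    and zero: "\<And>i. snd z ** plane_derivative E z i ** snd z = 0"
  shows "normal_curvature E (flat_curvature E) z = 0"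
proof -
  have "(flat_curvature E z $ i - plane_derivative E z i) ** snd z = 0" for i
  proof -
    let ?P = "snd z" and ?R = "plane_derivative E z i"
    have "flat_curvature E z $ i ** ?P = ?R ** (?P ** ?P) + ?P ** transpose ?R ** ?P"
      by (simp add: flat_curvature_def matrix_matrix_mult_add_rdistrib matrix_transpose_mul sym matrix_mul_assoc)
    also have "?P ** transpose ?R ** ?P = transpose (?P ** ?R ** ?P)"
      by (simp add: matrix_transpose_mul sym matrix_mul_assoc)
    also have "\<dots> = 0"
      unfolding zero by (simp add: transpose_def vec_eq_iff)
    finally have "flat_curvature E z $ i ** ?P = ?R ** ?P"
      by (simp add: idem)
    then have "(flat_curvature E z $ i - ?R) ** ?P + ?R ** ?P = 0 + ?R ** ?P"
      by (simp flip: matrix_matrix_mult_add_rdistrib)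
    then show ?thesis by simp
  qed
  then show ?thesis
    by (simp add: normal_curvature_def vec_eq_iff transpose_def)
qed

text \<open>On the compact product of \<open>G\<close> with the sphere of radius \<epsilon>,
  \<open>F\<close> has a positive minimum \<mu>. A longer \<open>q\<close> is scaled back to that
  sphere; since \<open>F z 0 = 0\<close>, convexity on the segment from 0 gives
  \<open>norm q \<le> \<epsilon> / \<mu> * F z q\<close>.\<close>

lemma condF_coercive:
  fixes F :: "(real^'s) \<times> (real^'s^'s) \<Rightarrow> real^'s^'s^'s \<Rightarrow> real"
  assumes F: "condF G F" and G: "compact G" and e: "\<epsilon> > 0"
  obtains C where "C > 0" "\<And>z q. z \<in> G \<Longrightarrow> norm q \<le> \<epsilon> + C * F z q"
proof (cases "G = {}")
  case True
  then show thesis using that[of 1] by simp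
next
  case False
  define S where "S = G \<times> sphere (0::real^'s^'s^'s) \<epsilon>"
  have "compact S"
    unfolding S_def by (intro compact_Times G compact_sphere)
  moreover have "S \<noteq> {}"
    unfolding S_def using False e by simp
  moreover have "continuous_on S (\<lambda>(z, q). F z q)"
    using F unfolding condF_def S_def by (meson Sigma_mono continuous_on_subset order_refl subset_UNIV)
  ultimately obtain w where w: "w \<in> S" "\<And>y. y \<in> S \<Longrightarrow> (\<lambda>(z, q). F z q) w \<le> (\<lambda>(z, q). F z q) y"
    using continuous_attains_inf by metis
  define \<mu> where "\<mu> = (\<lambda>(z, q). F z q) w"
  have Fpos: "F z q \<ge> 0" "F z q = 0 \<longleftrightarrow> q = 0" if "z \<in> G" for z q
    using F that unfolding condF_def by auto
  have \<mu>: "\<mu> > 0"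
    using w(1) e Fpos unfolding \<mu>_def S_def by (force simp: less_le)
  show thesis
  proof (rule that[of "\<epsilon> / \<mu>"])
    show "\<epsilon> / \<mu> > 0" using e \<mu> by simp
    fix z q assume z: "z \<in> G"
    show "norm q \<le> \<epsilon> + \<epsilon> / \<mu> * F z q"
    proof (cases "norm q \<le> \<epsilon>")
      case True
      moreover have "0 \<le> \<epsilon> / \<mu> * F z q"
        using e \<mu> Fpos(1)[OF z] by simp
      ultimately show ?thesis by linarith
    next
      case False
      define t where "t = \<epsilon> / norm q"
      have t: "0 \<le> t" "t \<le> 1" "t * norm q = \<epsilon>"
        using False e by (auto simp: t_def divide_le_eq_1)
      have "(z, t *\<^sub>R q) \<in> S"
        using z t by (simp add: S_def)
      then have "\<mu> \<le> F z (t *\<^sub>R q)"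
        using w(2)[of "(z, t *\<^sub>R q)"] by (simp add: \<mu>_def)
      also have "\<dots> \<le> (1 - t) * F z 0 + t * F z q"
        using F z t convex_onD[of UNIV "F z" t 0 q] unfolding condF_def by simp
      also have "\<dots> = t * F z q"
        using Fpos(2)[OF z, of 0] by simp
      finally have "\<mu> * norm q \<le> t * F z q * norm q"
        by (rule mult_right_mono) simp
      also have "\<dots> = \<epsilon> * F z q"
        using t(3) by (simp add: mult_ac)
      finally have "\<mu> * norm q \<le> \<epsilon> * F z q" .
      then have "norm q \<le> \<epsilon> / \<mu> * F z q"
        using \<mu> by (simp add: field_simps)
      then show ?thesis using e by linarith
    qed
  qed
qed

text \<open>Supplies an admissible integrand for (iii) to (ii). The growth function is
  \<open>t\<close> itself, because the squared norm is \<open>norm q * norm q\<close>.\<close>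

lemma condF_norm_squared: "condF G (\<lambda>(z :: (real^'s) \<times> (real^'s^'s)) q :: real^'s^'s^'s. (norm q)\<^sup>2)"
  unfolding condF_def
proof (intro conjI exI[of _ "\<lambda>z t. t"])
  show "continuous_on (G \<times> UNIV) (\<lambda>(z, q::real^'s^'s^'s). (norm q)\<^sup>2)"
    unfolding split_beta by (intro continuous_intros)
  show "continuous_on (G \<times> {0..}) (\<lambda>(z, t::real). t)"
    unfolding split_beta by (intro continuous_intros)
  show "\<forall>z\<in>G. convex_on UNIV (\<lambda>q::real^'s^'s^'s. (norm q)\<^sup>2)"
  proof (rule ballI, rule convex_onI)
    fix t :: real and x y :: "real^'s^'s^'s"
    assume t: "0 < t" "t < 1"
    have "norm ((1 - t) *\<^sub>R x + t *\<^sub>R y) \<le> (1 - t) * norm x + t * norm y"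
      using norm_triangle_ineq[of "(1 - t) *\<^sub>R x" "t *\<^sub>R y"] t by simp
    then have "(norm ((1 - t) *\<^sub>R x + t *\<^sub>R y))\<^sup>2 \<le> ((1 - t) * norm x + t * norm y)\<^sup>2"
      by (intro power_mono) auto
    also have "\<dots> \<le> (1 - t) * (norm x)\<^sup>2 + t * (norm y)\<^sup>2"
      using convex_onD[OF convex_power2, of t "norm x" "norm y"] t by simp
    finally show "(norm ((1 - t) *\<^sub>R x + t *\<^sub>R y))\<^sup>2 \<le> (1 - t) * (norm x)\<^sup>2 + t * (norm y)\<^sup>2" .
  qed simp
  show "\<forall>z0\<in>G. \<exists>e>0. \<forall>M. \<exists>T. \<forall>t::real\<ge>T. \<forall>z\<in>G \<inter> ball z0 e. M \<le> t"
    using zero_less_one by blast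
qed (auto simp: power2_eq_square mono_on_def)

section \<open>Limits with vanishing energy\<close>

text \<open>The defining identity of \<open>B\<close> is linear in the measure, so the rescaled
  varifold has the same curvature function.\<close>

lemma normalized_varifold:
  assumes V: "varifold m Nbar N V" and G: "compact (Gm m Nbar N)" and B: "gen_curvature V B"
    and pos: "measure V (space V) > 0"
  obtains W where "varifold m Nbar N W" "prob_space W" "gen_curvature W B"
    "\<And>f :: _ \<Rightarrow> real. f \<in> borel_measurable V \<Longrightarrow> integral\<^sup>L W f = integral\<^sup>L V f / measure V (space V)"
proof -
  note VD = varifoldD[OF V G]
  interpret finite_measure V by (rule VD(2))
  define c where "c = 1 / measure V (space V)"
  have c: "c > 0" using pos by (simp add: c_def)
  define W where "W = density V (\<lambda>_. ennreal c)"
  have em: "emeasure W A = ennreal c * emeasure V A" if "A \<in> sets V" for A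
    unfolding W_def using that by (rule emeasure_density_const)
  have sp: "space W = space V" "sets W = sets V" by (simp_all add: W_def)
  have Wint: "integral\<^sup>L W f = integral\<^sup>L V f / measure V (space V)"
    if "f \<in> borel_measurable V" for f :: "_ \<Rightarrow> real"
    unfolding W_def using that c by (subst integral_density) (auto simp: c_def)
  have total: "emeasure W (space W) = 1"
    using pos by (simp add: em sp emeasure_eq_measure c_def ennreal_mult[symmetric])
  show thesis
  proof (rule that[of W])
    show "prob_space W" using total by (rule prob_spaceI)
    have "space V - Gm m Nbar N \<in> sets V"
      using borel_compact[OF G] VD(1) by (auto simp: VD(1) sets_eq_imp_space_eq[OF VD(1)])
    then show "varifold m Nbar N W"
      using V total by (simp add: varifold_def sp em)
    have Bint: "\<And>i j k. integrable V (\<lambda>z. B z $ i $ j $ k)"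
      using B by (simp add: gen_curvature_iff)
    show "gen_curvature W B"
      unfolding gen_curvature_iff
    proof (intro conjI allI impI)
      show "integrable W (\<lambda>z. B z $ i $ j $ k)" for i j k
        unfolding W_def using c Bint[of i j k] by (subst integrable_density) auto
      show "integral\<^sup>L W (first_variation_integrand B \<phi> i) = 0" if "C1c \<phi>" for \<phi> i
        using B that borel_measurable_first_variation_integrand[OF VD(1) Bint that]
        by (simp add: Wint gen_curvature_iff)
    qed
  qed (rule Wint)
qed

lemma continuous_on_flat_curvature:
  assumes "\<And>q. continuous_on UNIV (E q)"
  shows "continuous_on UNIV (\<lambda>z. plane_derivative E z i $ j $ k)"
    "continuous_on UNIV (\<lambda>z. flat_curvature E z $ i $ j $ k)"
proof -
  show pd: "continuous_on UNIV (\<lambda>z. plane_derivative E z i $ j $ k)" for i j k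
    unfolding plane_derivative_def
    by (intro continuous_intros continuous_on_compose2[OF assms]) auto
  show "continuous_on UNIV (\<lambda>z. flat_curvature E z $ i $ j $ k)"
    unfolding flat_curvature_def transpose_def matrix_matrix_mult_def
    by (simp, intro continuous_intros pd)
qed

lemma integrable_normal_curvature:
  assumes V: "varifold m Nbar N V" and G: "compact (Gm m Nbar N)" and B: "gen_curvature V B"
    and E: "\<And>q. continuous_on UNIV (E q)"
  shows "integrable V (\<lambda>z. normal_curvature E B z $ i $ j $ k)"
proof -
  note VD = varifoldD[OF V G]
  have eq: "normal_curvature E B z $ i $ j $ k =
      (\<Sum>l\<in>UNIV. (B z $ i $ k $ l - plane_derivative E z i $ k $ l) * snd z $ l $ j)" for z
    by (simp add: normal_curvature_def transpose_def matrix_matrix_mult_def)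
  have Bint: "integrable V (\<lambda>z. B z $ i $ j $ k)" for i j k
    using B by (simp add: gen_curvature_iff)
  have pd: "integrable V (\<lambda>z. plane_derivative E z i $ j $ k)" for i j k
    by (intro integrable_continuous_on_compact[OF VD(1,2) G VD(3)] continuous_on_flat_curvature E)
  show ?thesis
    unfolding eq
    by (intro Bochner_Integration.integrable_sum integrable_mult_continuous_on_compact[OF VD(1) G VD(3)]
        Bochner_Integration.integrable_diff Bint pd continuous_intros)
qed

text \<open>Replacing \<open>B n\<close> by the flat curvature changes the integrand by
  \<open>R n\<close>, linear in the normal curvature with coefficients \<phi> and its
  \<open>P\<close>-derivatives, which are bounded on the compact carrier. The integral with
  \<open>B n\<close> is 0, so the one with the flat curvature is minus the integral of
  \<open>R n\<close>.\<close>

lemma first_variation_integrand_flat_limit: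
  fixes V :: "nat \<Rightarrow> ((real^'s) \<times> (real^'s^'s)) measure"
  assumes V: "\<And>n. varifold m Nbar N (V n)" and G: "compact (Gm m Nbar N)"
    and B: "\<And>n. gen_curvature (V n) (B n)" and E: "\<And>q. continuous_on UNIV (E q)"
    and small: "\<And>i j k. (\<lambda>n. \<integral>z. \<bar>normal_curvature E (B n) z $ i $ j $ k\<bar> \<partial>V n) \<longlonglongrightarrow> 0"
    and \<phi>: "C1c \<phi>"
  shows "(\<lambda>n. integral\<^sup>L (V n) (first_variation_integrand (flat_curvature E) \<phi> i)) \<longlonglongrightarrow> 0"
proof -
  note VD = varifoldD[OF V G]
  define \<alpha> where "\<alpha> n i j k z = normal_curvature E (B n) z $ i $ j $ k" for n i j k z
  have \<alpha>int: "integrable (V n) (\<lambda>z. \<alpha> n i j k z * b z)" if "continuous_on UNIV b" for n i j k b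
    unfolding \<alpha>_def
    by (intro integrable_mult_continuous_on_compact[OF VD(1) G VD(3) that] integrable_normal_curvature[OF V G B E])
  have \<alpha>lim: "(\<lambda>n. \<integral>z. \<alpha> n i j k z * b z \<partial>V n) \<longlonglongrightarrow> 0" if b: "continuous_on UNIV b" for i j k b
  proof -
    obtain C where C: "\<And>z. z \<in> Gm m Nbar N \<Longrightarrow> norm (b z) \<le> C"
      using compact_continuous_image[OF continuous_on_subset[OF b] G]
      by (metis bounded_iff compact_imp_bounded image_eqI subset_UNIV)
    show ?thesis
    proof (rule Lim_null_comparison)
      show "\<forall>\<^sub>F n in sequentially. norm (\<integral>z. \<alpha> n i j k z * b z \<partial>V n) \<le> C * (\<integral>z. \<bar>\<alpha> n i j k z\<bar> \<partial>V n)"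
      proof (rule always_eventually, rule allI)
        fix n
        have "norm (\<integral>z. \<alpha> n i j k z * b z \<partial>V n) \<le> (\<integral>z. norm (\<alpha> n i j k z * b z) \<partial>V n)"
          by (rule integral_norm_bound)
        also have "\<dots> \<le> (\<integral>z. C * \<bar>\<alpha> n i j k z\<bar> \<partial>V n)"
        proof (rule integral_mono_AE)
          show "integrable (V n) (\<lambda>z. norm (\<alpha> n i j k z * b z))"
            using \<alpha>int[OF b] by (rule integrable_norm)
          show "integrable (V n) (\<lambda>z. C * \<bar>\<alpha> n i j k z\<bar>)"
            unfolding \<alpha>_def using integrable_normal_curvature[OF V G B E] by simp
          show "AE z in V n. norm (\<alpha> n i j k z * b z) \<le> C * \<bar>\<alpha> n i j k z\<bar>"
            using VD(3)[of n]
          proof eventually_elim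
            case (elim z)
            have "\<bar>\<alpha> n i j k z\<bar> * \<bar>b z\<bar> \<le> \<bar>\<alpha> n i j k z\<bar> * C"
              using C[OF elim] by (intro mult_left_mono) auto
            then show ?case by (simp add: abs_mult mult.commute)
          qed
        qed
        finally show "norm (\<integral>z. \<alpha> n i j k z * b z \<partial>V n) \<le> C * (\<integral>z. \<bar>\<alpha> n i j k z\<bar> \<partial>V n)"
          by simp
      qed
      show "(\<lambda>n. C * (\<integral>z. \<bar>\<alpha> n i j k z\<bar> \<partial>V n)) \<longlonglongrightarrow> 0"
        using tendsto_mult_left[OF small, of C] by (simp add: \<alpha>_def)
    qed
  qed
  note cont = continuous_on_test_derivatives[OF \<phi>]
  \<comment> \<open>The second sum comes from the trace term \<open>B_jij\<close>: with the last two
    indices exchanged, it contributes both index orders \<open>j j i\<close> and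
    \<open>j i j\<close>.\<close>
  define R where "R n z = (\<Sum>j\<in>UNIV. \<Sum>k\<in>UNIV. \<alpha> n i k j z * DP \<phi> j k z + \<alpha> n i j k z * DP \<phi> j k z)
      + (\<Sum>j\<in>UNIV. \<alpha> n j j i z * \<phi> z + \<alpha> n j i j z * \<phi> z)" for n z
  have Rint: "integrable (V n) (R n)" for n
    unfolding R_def
    by (intro Bochner_Integration.integrable_add Bochner_Integration.integrable_sum \<alpha>int cont)
  have "(\<integral>z. R n z \<partial>V n) = (\<Sum>j\<in>UNIV. \<Sum>k\<in>UNIV. (\<integral>z. \<alpha> n i k j z * DP \<phi> j k z \<partial>V n) + (\<integral>z. \<alpha> n i j k z * DP \<phi> j k z \<partial>V n))
      + (\<Sum>j\<in>UNIV. (\<integral>z. \<alpha> n j j i z * \<phi> z \<partial>V n) + (\<integral>z. \<alpha> n j i j z * \<phi> z \<partial>V n))" for n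
    unfolding R_def
    by (simp add: Bochner_Integration.integral_add Bochner_Integration.integral_sum
        Bochner_Integration.integrable_add Bochner_Integration.integrable_sum \<alpha>int cont)
  moreover have "(\<lambda>n. (\<Sum>j\<in>UNIV. \<Sum>k\<in>UNIV. (\<integral>z. \<alpha> n i k j z * DP \<phi> j k z \<partial>V n) + (\<integral>z. \<alpha> n i j k z * DP \<phi> j k z \<partial>V n))
      + (\<Sum>j\<in>UNIV. (\<integral>z. \<alpha> n j j i z * \<phi> z \<partial>V n) + (\<integral>z. \<alpha> n j i j z * \<phi> z \<partial>V n)))
      \<longlonglongrightarrow> (\<Sum>j\<in>(UNIV::'s set). \<Sum>k\<in>(UNIV::'s set). 0 + 0) + (\<Sum>j\<in>(UNIV::'s set). 0 + 0)"
    by (intro tendsto_add tendsto_sum \<alpha>lim cont)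
  ultimately have Rlim: "(\<lambda>n. integral\<^sup>L (V n) (R n)) \<longlonglongrightarrow> 0" by simp
  have Hint: "integrable (V n) (first_variation_integrand (flat_curvature E) \<phi> i)" for n
    unfolding first_variation_integrand_def[abs_def]
    by (intro integrable_continuous_on_compact[OF VD(1,2) G VD(3)] continuous_intros cont
        continuous_on_flat_curvature E)
  have "integral\<^sup>L (V n) (first_variation_integrand (flat_curvature E) \<phi> i) = - integral\<^sup>L (V n) (R n)" for n
  proof -
    have Bint: "\<And>i j k. integrable (V n) (\<lambda>z. B n z $ i $ j $ k)"
      using B[of n] by (simp add: gen_curvature_iff)
    have "AE z in V n. first_variation_integrand (B n) \<phi> i z =
        first_variation_integrand (flat_curvature E) \<phi> i z + R n z"
      using curvature_from_normal_curvature[OF V G B, of n E]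
    proof eventually_elim
      case (elim z)
      then have b: "B n z $ i $ j $ k = \<alpha> n i k j z + \<alpha> n i j k z + flat_curvature E z $ i $ j $ k" for i j k
        unfolding \<alpha>_def by blast
      show ?case
        unfolding first_variation_integrand_def R_def b
        by (simp add: sum.distrib sum_distrib_right distrib_right)
    qed
    then have "integral\<^sup>L (V n) (first_variation_integrand (B n) \<phi> i) =
        (\<integral>z. first_variation_integrand (flat_curvature E) \<phi> i z + R n z \<partial>V n)"
      by (intro integral_cong_AE borel_measurable_first_variation_integrand[OF VD(1) Bint \<phi>]
          borel_measurable_add borel_measurable_integrable Hint Rint)
    also have "\<dots> = integral\<^sup>L (V n) (first_variation_integrand (flat_curvature E) \<phi> i) + integral\<^sup>L (V n) (R n)"
      by (intro Bochner_Integration.integral_add Hint Rint)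
    finally show ?thesis
      using B[of n] \<phi> by (simp add: gen_curvature_iff)
  qed
  then show ?thesis
    using tendsto_minus[OF Rlim] by simp
qed

text \<open>For the flat curvature the integrand is one continuous function of
  \<open>(x, P)\<close>, the same for all \<open>n\<close>, so weak convergence evaluates its
  limit.\<close>

lemma flat_limit_varifold:
  fixes V :: "nat \<Rightarrow> ((real^'s) \<times> (real^'s^'s)) measure"
  assumes V: "\<And>n. varifold m Nbar N (V n)" and prob: "\<And>n. prob_space (V n)"
    and G: "compact (Gm m Nbar N)"
    and B: "\<And>n. gen_curvature (V n) (B n)" and E: "\<And>q. continuous_on UNIV (E q)"
    and small: "\<And>i j k. (\<lambda>n. \<integral>z. \<bar>normal_curvature E (B n) z $ i $ j $ k\<bar> \<partial>V n) \<longlonglongrightarrow> 0"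
  obtains W where "varifold m Nbar N W" "prob_space W" "gen_curvature W (flat_curvature E)"
proof -
  note VD = varifoldD[OF V G]
  obtain r W where r: "strict_mono (r :: nat \<Rightarrow> nat)" and W: "prob_space W" "sets W = sets borel"
    "AE z in W. z \<in> Gm m Nbar N"
    and conv: "\<And>g :: _ \<Rightarrow> real. continuous_on UNIV g \<Longrightarrow> (\<lambda>n. integral\<^sup>L (V (r n)) g) \<longlonglongrightarrow> integral\<^sup>L W g"
    by (rule weak_limit_of_compactly_supported[where \<mu> = V, OF prob VD(1) G VD(3)]) blast
  have fin: "finite_measure W"
    using W(1) by (rule prob_space.finite_measure)
  show thesis
  proof (rule that[of W])
    have "emeasure W {z \<in> space W. z \<notin> Gm m Nbar N} = 0"
      using W(3) by (intro emeasure_eq_0_AE) simp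
    moreover have "{z \<in> space W. z \<notin> Gm m Nbar N} = space W - Gm m Nbar N" by auto
    ultimately show "varifold m Nbar N W"
      using W(1,2) by (simp add: varifold_def prob_space.emeasure_space_1)
    show "gen_curvature W (flat_curvature E)"
      unfolding gen_curvature_iff
    proof (intro conjI allI impI)
      show "integrable W (\<lambda>z. flat_curvature E z $ i $ j $ k)" for i j k
        by (intro integrable_continuous_on_compact[OF W(2) fin G W(3)] continuous_on_flat_curvature E)
      fix \<phi> :: "(real^'s) \<times> (real^'s^'s) \<Rightarrow> real" and i assume \<phi>: "C1c \<phi>"
      have "continuous_on UNIV (first_variation_integrand (flat_curvature E) \<phi> i)"
        unfolding first_variation_integrand_def[abs_def]
        by (intro continuous_intros continuous_on_test_derivatives[OF \<phi>] continuous_on_flat_curvature E)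
      then have "(\<lambda>n. integral\<^sup>L (V (r n)) (first_variation_integrand (flat_curvature E) \<phi> i)) \<longlonglongrightarrow>
          integral\<^sup>L W (first_variation_integrand (flat_curvature E) \<phi> i)"
        by (rule conv)
      moreover have "(\<lambda>n. integral\<^sup>L (V (r n)) (first_variation_integrand (flat_curvature E) \<phi> i)) \<longlonglongrightarrow> 0"
        using LIMSEQ_subseq_LIMSEQ[OF first_variation_integrand_flat_limit[OF V G B E small \<phi>] r]
        by (simp add: o_def)
      ultimately show "integral\<^sup>L W (first_variation_integrand (flat_curvature E) \<phi> i) = 0"
        by (rule LIMSEQ_unique)
    qed
  qed (rule W(1))
qed

lemma null_varifold_exists:
  fixes Q :: "real^'s \<Rightarrow> real^'s^'s" and V :: "nat \<Rightarrow> ((real^'s) \<times> (real^'s^'s)) measure"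
  assumes NsubNbar: "N \<subseteq> Nbar" and Ncompact: "compact N"
    and U0: "Nbar \<subseteq> U0" and Q_C1: "Ck_on 1 U0 Q"
    and Q_proj: "\<forall>x\<in>Nbar. is_orth_proj (tangent_space Nbar x) (Q x)"
    and F: "condF (Gm m Nbar N) F"
    and V: "\<And>n. varifold m Nbar N (V n)" and B: "\<And>n. gen_curvature (V n) (B n)"
    and large: "\<And>n. \<not> emeasure (V n) (space (V n)) \<le>
        ennreal (real (Suc n)) * (\<integral>\<^sup>+ z. ennreal (F z (sff Q (B n) z)) \<partial>V n)"
  shows "\<exists>W B. varifold m Nbar N W \<and> emeasure W (space W) \<noteq> 0 \<and> gen_curvature W B \<and>
           (AE z in W. sff Q B z = 0)"
proof -
  have Qdiff: "(Q has_derivative frechet_derivative Q (at x)) (at x)" if "x \<in> Nbar" for x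
    using Q_C1 U0 that by (auto simp: frechet_derivative_works[symmetric])
  have "continuous_on N Q"
    using Qdiff NsubNbar by (meson continuous_at_imp_continuous_on has_derivative_continuous subsetD)
  then have G: "compact (Gm m Nbar N)"
    using compact_Gm[OF NsubNbar Q_proj Ncompact] by blast
  note VD = varifoldD[OF V G]
  \<comment> \<open>Weak convergence is tested with functions continuous on the whole space, while
    the derivatives of \<open>Q\<close> are controlled on \<open>U0\<close> only. Dugundji's theorem
    extends them from the closed set \<open>N\<close>; on the carrier nothing changes.\<close>
  have "\<exists>g. continuous_on UNIV g \<and> (\<forall>x\<in>N. g x = frechet_derivative Q (at x) (axis q 1))" for q
  proof -
    have "continuous_on N (\<lambda>x. frechet_derivative Q (at x) (axis q 1))" (is "continuous_on N ?D")
    proof (rule continuous_on_subset)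
      show "continuous_on U0 ?D" using Q_C1 by simp
      show "N \<subseteq> U0" using U0 NsubNbar by blast
    qed
    note D = this
    have N: "closedin (top_of_set UNIV) N"
      using compact_imp_closed[OF Ncompact] by simp
    show ?thesis
    proof (rule Dugundji[OF convex_UNIV UNIV_not_empty N D subset_UNIV])
      fix g :: "real^'s \<Rightarrow> real^'s^'s"
      assume "continuous_on UNIV g" "\<And>x. x \<in> N \<Longrightarrow> g x = ?D x"
      then show ?thesis by (intro exI[of _ g] conjI ballI)
    qed
  qed
  then have "\<exists>E. \<forall>q. continuous_on UNIV (E q) \<and> (\<forall>x\<in>N. E q x = frechet_derivative Q (at x) (axis q 1))"
    by (intro choice allI)
  then obtain E where E: "\<And>q. continuous_on UNIV (E q)"
    and EQ: "\<And>q x. x \<in> N \<Longrightarrow> E q x = frechet_derivative Q (at x) (axis q 1)"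
    by blast
  have sffE: "sff Q B' z = normal_curvature E B' z" if "z \<in> Gm m Nbar N" for B' z
    using that unfolding sff_eq_normal_curvature normal_curvature_def plane_derivative_def
    by (auto simp: Gm_def EQ)
  have fin: "emeasure (V n) (space (V n)) = ennreal (measure (V n) (space (V n)))" for n
    using VD(2) by (rule finite_measure.emeasure_eq_measure)
  have pos: "measure (V n) (space (V n)) > 0" for n
  proof (rule ccontr)
    assume "\<not> measure (V n) (space (V n)) > 0"
    then have "emeasure (V n) (space (V n)) = 0"
      unfolding fin by (simp add: ennreal_neg not_less)
    then show False using large[of n] by simp
  qed
  have energy: "(\<integral>\<^sup>+ z. ennreal (F z (sff Q (B n) z)) \<partial>V n) \<le> ennreal (measure (V n) (space (V n)) / real (Suc n))" for n
  proof -
    let ?J = "\<integral>\<^sup>+ z. ennreal (F z (sff Q (B n) z)) \<partial>V n"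
    have "ennreal (real (Suc n)) * ?J \<le> ennreal (measure (V n) (space (V n)))"
      using large[of n] unfolding fin by simp
    then have "ennreal (1 / real (Suc n)) * (ennreal (real (Suc n)) * ?J) \<le>
        ennreal (1 / real (Suc n)) * ennreal (measure (V n) (space (V n)))"
      by (rule mult_left_mono) simp
    moreover have "ennreal (1 / real (Suc n)) * ennreal (real (Suc n)) = 1"
      by (simp add: ennreal_mult[symmetric] del: of_nat_Suc)
    ultimately show ?thesis
      by (simp add: mult.assoc[symmetric] ennreal_mult[symmetric] del: of_nat_Suc)
  qed
  let ?\<alpha> = "\<lambda>n i j k z. normal_curvature E (B n) z $ i $ j $ k"
  \<comment> \<open>\<open>C\<close> depends on \<epsilon> but not on \<open>n\<close>, so
    \<epsilon> can be fixed before \<open>n\<close> tends to infinity.\<close>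
  have bound: "\<exists>C. \<forall>n. (\<integral>z. \<bar>?\<alpha> n i j k z\<bar> \<partial>V n) / measure (V n) (space (V n)) \<le> \<epsilon> + C / real (Suc n)"
    if e: "\<epsilon> > 0" for \<epsilon> i j k
  proof -
    obtain C where C: "C > 0" "\<And>z q. z \<in> Gm m Nbar N \<Longrightarrow> norm q \<le> \<epsilon> + C * F z q"
      using condF_coercive[OF F G e] by blast
    show ?thesis
    proof (intro exI allI)
      fix n
      interpret finite_measure "V n" by (rule VD(2))
      let ?M = "measure (V n) (space (V n))"
      have \<alpha>int: "integrable (V n) (\<lambda>z. \<bar>?\<alpha> n i j k z\<bar>)"
        using integrable_normal_curvature[OF V G B E] by simp
      \<comment> \<open>The comparison runs through nonnegative integrals since measurability of the
        energy integrand is not established. \<open>ennreal\<close> sends the negative values of the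
        left side to 0.\<close>
      have "AE z in V n. ennreal ((\<bar>?\<alpha> n i j k z\<bar> - \<epsilon>) / C) \<le> ennreal (F z (sff Q (B n) z))"
        using VD(3)[of n]
      proof eventually_elim
        case (elim z)
        let ?A = "normal_curvature E (B n) z"
        have "\<bar>?\<alpha> n i j k z\<bar> \<le> norm ?A"
          using component_le_norm_cart[of "?A $ i $ j" k] Finite_Cartesian_Product.norm_nth_le[of "?A $ i" j] Finite_Cartesian_Product.norm_nth_le[of ?A i]
          by linarith
        also have "\<dots> \<le> \<epsilon> + C * F z (sff Q (B n) z)"
          unfolding sffE[OF elim] by (rule C(2)[OF elim])
        finally show ?case
          using C(1) by (intro ennreal_leI) (simp add: field_simps)
      qed
      then have "(\<integral>\<^sup>+ z. ennreal ((\<bar>?\<alpha> n i j k z\<bar> - \<epsilon>) / C) \<partial>V n) \<le> ennreal (?M / real (Suc n))"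
        by (rule order_trans[OF nn_integral_mono_AE energy])
      then have "(\<integral>z. (\<bar>?\<alpha> n i j k z\<bar> - \<epsilon>) / C \<partial>V n) \<le> ?M / real (Suc n)"
        by (rule integral_real_bounded[rotated]) simp
      moreover have "(\<integral>z. (\<bar>?\<alpha> n i j k z\<bar> - \<epsilon>) / C \<partial>V n) = ((\<integral>z. \<bar>?\<alpha> n i j k z\<bar> \<partial>V n) - \<epsilon> * ?M) / C"
        using \<alpha>int by (simp add: Bochner_Integration.integral_diff)
      ultimately have "(\<integral>z. \<bar>?\<alpha> n i j k z\<bar> \<partial>V n) \<le> \<epsilon> * ?M + C * (?M / real (Suc n))"
        using C(1) by (simp add: divide_le_eq mult.commute del: of_nat_Suc)
      then have "(\<integral>z. \<bar>?\<alpha> n i j k z\<bar> \<partial>V n) / ?M \<le> (\<epsilon> * ?M + C * (?M / real (Suc n))) / ?M"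
        using pos[of n] by (intro divide_right_mono) auto
      also have "\<dots> = \<epsilon> + C / real (Suc n)"
        using pos[of n] by (simp add: add_divide_distrib del: of_nat_Suc)
      finally show "(\<integral>z. \<bar>?\<alpha> n i j k z\<bar> \<partial>V n) / ?M \<le> \<epsilon> + C / real (Suc n)" .
    qed
  qed
  have "\<forall>n. \<exists>W. varifold m Nbar N W \<and> prob_space W \<and> gen_curvature W (B n) \<and>
      (\<forall>f :: _ \<Rightarrow> real. f \<in> borel_measurable (V n) \<longrightarrow> integral\<^sup>L W f = integral\<^sup>L (V n) f / measure (V n) (space (V n)))"
  proof
    fix n
    show "\<exists>W. varifold m Nbar N W \<and> prob_space W \<and> gen_curvature W (B n) \<and>
      (\<forall>f :: _ \<Rightarrow> real. f \<in> borel_measurable (V n) \<longrightarrow> integral\<^sup>L W f = integral\<^sup>L (V n) f / measure (V n) (space (V n)))"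
      by (rule normalized_varifold[OF V G B pos, of n]) blast
  qed
  from choice[OF this] obtain W where "\<forall>n. varifold m Nbar N (W n) \<and> prob_space (W n) \<and> gen_curvature (W n) (B n) \<and>
      (\<forall>f :: _ \<Rightarrow> real. f \<in> borel_measurable (V n) \<longrightarrow> integral\<^sup>L (W n) f = integral\<^sup>L (V n) f / measure (V n) (space (V n)))" ..
  then have W: "\<And>n. varifold m Nbar N (W n)" "\<And>n. prob_space (W n)" "\<And>n. gen_curvature (W n) (B n)"
    and Wint: "\<And>n (f :: _ \<Rightarrow> real). f \<in> borel_measurable (V n) \<Longrightarrow>
        integral\<^sup>L (W n) f = integral\<^sup>L (V n) f / measure (V n) (space (V n))"
    by simp_all
  have small: "(\<lambda>n. \<integral>z. \<bar>?\<alpha> n i j k z\<bar> \<partial>W n) \<longlonglongrightarrow> 0" for i j k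
  proof (rule LIMSEQ_I)
    fix e :: real assume e: "e > 0"
    then obtain C where C: "\<And>n. (\<integral>z. \<bar>?\<alpha> n i j k z\<bar> \<partial>V n) / measure (V n) (space (V n)) \<le> e / 2 + C / real (Suc n)"
      using bound[of "e / 2" i j k] by auto
    have "(\<lambda>n. C * inverse (real (Suc n))) \<longlonglongrightarrow> C * 0"
      by (intro tendsto_intros LIMSEQ_inverse_real_of_nat)
    then have "\<forall>\<^sub>F n in sequentially. C * inverse (real (Suc n)) < e / 2"
      using e by (intro order_tendstoD(2)) auto
    then obtain n0 where n0: "\<And>n. n \<ge> n0 \<Longrightarrow> C * inverse (real (Suc n)) < e / 2"
      by (auto simp: eventually_sequentially)
    have "norm ((\<integral>z. \<bar>?\<alpha> n i j k z\<bar> \<partial>W n) - 0) < e" if "n \<ge> n0" for n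
    proof -
      have "(\<lambda>z. \<bar>?\<alpha> n i j k z\<bar>) \<in> borel_measurable (V n)"
        using integrable_normal_curvature[OF V G B E] by measurable
      then have "(\<integral>z. \<bar>?\<alpha> n i j k z\<bar> \<partial>W n) \<le> e / 2 + C / real (Suc n)"
        using C[of n] by (simp add: Wint)
      moreover have "C / real (Suc n) < e / 2"
        using n0[OF that] by (simp only: divide_inverse)
      moreover have "0 \<le> (\<integral>z. \<bar>?\<alpha> n i j k z\<bar> \<partial>W n)"
        by (rule integral_nonneg_AE) simp
      ultimately show ?thesis
        unfolding real_norm_def by linarith
    qed
    then show "\<exists>n0. \<forall>n\<ge>n0. norm ((\<integral>z. \<bar>?\<alpha> n i j k z\<bar> \<partial>W n) - 0) < e" by blast
  qed
  obtain L where L: "varifold m Nbar N L" "prob_space L" "gen_curvature L (flat_curvature E)"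
    by (rule flat_limit_varifold[where V = W, OF W(1,2) G W(3) E small])
  have "AE z in L. sff Q (flat_curvature E) z = 0"
    using varifoldD(3)[OF L(1) G]
  proof eventually_elim
    case (elim z)
    then obtain x P where z: "z = (x, P)" "x \<in> N" "P ** P = P" "transpose P = P"
      "range ((*v) P) \<subseteq> tangent_space Nbar x"
      by (cases z) (auto simp: Gm_def Grass_def)
    have QP: "Q x ** P = P"
      using elim unfolding Gm_eq[OF NsubNbar Q_proj] z(1) by simp
    have x: "x \<in> Nbar" using z(2) NsubNbar by auto
    have "P ** plane_derivative E z i ** P = 0" for i
    proof (rule projected_derivative_zero[OF _ QP _ z(4)])
      show "transpose (Q x) = Q x"
        using Q_proj x by (auto simp: is_orth_proj_def)
      let ?D = "frechet_derivative Q (at x)"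
      \<comment> \<open>Column \<open>i\<close> of \<open>P\<close> is written through row
        \<open>i\<close> by symmetry, so \<open>plane_derivative\<close> becomes a derivative of
        \<open>Q\<close> along a vector in the range of \<open>P\<close>, hence tangent to
        \<open>Nbar\<close>.\<close>
      have "P *v axis i 1 = (\<Sum>q\<in>UNIV. P $ i $ q *\<^sub>R axis q 1)"
      proof -
        have "P $ i $ k = P $ k $ i" for k
          using z(4) unfolding transpose_def vec_eq_iff by simp
        then show ?thesis
          unfolding matrix_vector_mult_basis
          by (simp add: vec_eq_iff column_def sum_component axis_def if_distrib[of "(*) _"] cong: if_cong)
      qed
      then have "?D (P *v axis i 1) = plane_derivative E z i"
        using has_derivative_linear[OF Qdiff[OF x]] z(1,2)
        by (simp add: plane_derivative_def EQ linear_sum linear_cmul)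
      moreover have "P *v axis i 1 \<in> tangent_space Nbar x"
        using z(5) by auto
      ultimately show "plane_derivative E z i = plane_derivative E z i ** Q x + Q x ** plane_derivative E z i"
        using tangential_derivative_of_projection[OF Q_proj Qdiff[OF x]] by metis
    qed
    then show ?case
      using normal_curvature_flat_curvature[of z E] z sffE[OF elim] by simp
  qed
  then show ?thesis
    using L prob_space.emeasure_space_1[OF L(2)] by (intro exI[of _ L] exI[of _ "flat_curvature E"]) simp
qed

section \<open>The cycle of implications\<close>

theorem theorem4p1:
  fixes Nbar N U0 :: "(real^'s) set"
    and Q :: "real^'s \<Rightarrow> real^'s^'s"
    and m :: nat
  assumes Nbar: "embedded_submanifold TYPE('n::finite) Nbar"
    and NsubNbar: "N \<subseteq> Nbar" and Ncompact: "compact N"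
    and m_ge: "1 \<le> m" and m_le: "m \<le> CARD('n) - 1"
    and O_open: "open U0" and O_sup: "Nbar \<subseteq> U0" and Q_C1: "Ck_on 1 U0 Q"
    and Q_proj: "\<forall>x\<in>Nbar. is_orth_proj (tangent_space Nbar x) (Q x)"
  shows
   "((\<not> (\<exists>V B. varifold m Nbar N V \<and> emeasure V (space V) \<noteq> 0 \<and> gen_curvature V B \<and>
              (AE z in V. sff Q B z = 0)))
     \<longleftrightarrow>
     (\<exists>(\<Phi>::real \<Rightarrow> real) F.
        mono_on {0..} \<Phi> \<and> \<Phi> 0 = 0 \<and> (\<forall>t\<ge>0. \<Phi> t \<ge> 0) \<and> condF (Gm m Nbar N) F \<and>
        (\<forall>V B. varifold m Nbar N V \<and> gen_curvature V B \<longrightarrow>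
           (\<integral>\<^sup>+ z. ennreal (F z (sff Q B z)) \<partial>V) \<noteq> \<infinity> \<longrightarrow>
           measure V (space V) \<le> \<Phi> (enn2real (\<integral>\<^sup>+ z. ennreal (F z (sff Q B z)) \<partial>V)))))
    \<and>
    ((\<exists>(\<Phi>::real \<Rightarrow> real) F.
        mono_on {0..} \<Phi> \<and> \<Phi> 0 = 0 \<and> (\<forall>t\<ge>0. \<Phi> t \<ge> 0) \<and> condF (Gm m Nbar N) F \<and>
        (\<forall>V B. varifold m Nbar N V \<and> gen_curvature V B \<longrightarrow>
           (\<integral>\<^sup>+ z. ennreal (F z (sff Q B z)) \<partial>V) \<noteq> \<infinity> \<longrightarrow>
           measure V (space V) \<le> \<Phi> (enn2real (\<integral>\<^sup>+ z. ennreal (F z (sff Q B z)) \<partial>V))))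
     \<longleftrightarrow>
     (\<forall>F. condF (Gm m Nbar N) F \<longrightarrow>
        (\<exists>C>0. \<forall>V B. varifold m Nbar N V \<and> gen_curvature V B \<longrightarrow>
           emeasure V (space V) \<le> ennreal C * (\<integral>\<^sup>+ z. ennreal (F z (sff Q B z)) \<partial>V))))"
    (is "(?I \<longleftrightarrow> ?II) \<and> (?II \<longleftrightarrow> ?III)")
proof -
  have "continuous_on N Q"
    using Q_C1 O_sup NsubNbar
    by (auto intro!: continuous_at_imp_continuous_on differentiable_imp_continuous_within)
  then have G: "compact (Gm m Nbar N)"
    using compact_Gm[OF NsubNbar Q_proj Ncompact] by blast
  have "?III" if I: "?I"
  proof (rule ccontr)
    assume "\<not> ?III"
    then obtain F where F: "condF (Gm m Nbar N) F"
      and noC: "\<And>C. C > 0 \<Longrightarrow> \<exists>V B. varifold m Nbar N V \<and> gen_curvature V B \<and>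
        \<not> emeasure V (space V) \<le> ennreal C * (\<integral>\<^sup>+ z. ennreal (F z (sff Q B z)) \<partial>V)"
      by blast
    \<comment> \<open>The constant is \<open>Suc n\<close> because (iii) fails only for positive
      constants.\<close>
    have "\<forall>n. \<exists>V B. varifold m Nbar N V \<and> gen_curvature V B \<and>
        \<not> emeasure V (space V) \<le> ennreal (real (Suc n)) * (\<integral>\<^sup>+ z. ennreal (F z (sff Q B z)) \<partial>V)"
      by (intro allI noC) simp
    then have "\<exists>V. \<forall>n. \<exists>B. varifold m Nbar N (V n) \<and> gen_curvature (V n) B \<and>
        \<not> emeasure (V n) (space (V n)) \<le> ennreal (real (Suc n)) * (\<integral>\<^sup>+ z. ennreal (F z (sff Q B z)) \<partial>V n)"
      by (rule choice)
    then obtain V where "\<forall>n. \<exists>B. varifold m Nbar N (V n) \<and> gen_curvature (V n) B \<and>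
        \<not> emeasure (V n) (space (V n)) \<le> ennreal (real (Suc n)) * (\<integral>\<^sup>+ z. ennreal (F z (sff Q B z)) \<partial>V n)" ..
    then have "\<exists>B. \<forall>n. varifold m Nbar N (V n) \<and> gen_curvature (V n) (B n) \<and>
        \<not> emeasure (V n) (space (V n)) \<le> ennreal (real (Suc n)) * (\<integral>\<^sup>+ z. ennreal (F z (sff Q (B n) z)) \<partial>V n)"
      by (rule choice)
    then obtain B where "\<forall>n. varifold m Nbar N (V n) \<and> gen_curvature (V n) (B n) \<and>
        \<not> emeasure (V n) (space (V n)) \<le> ennreal (real (Suc n)) * (\<integral>\<^sup>+ z. ennreal (F z (sff Q (B n) z)) \<partial>V n)" ..
    then have "\<not> ?I"
      using null_varifold_exists[OF NsubNbar Ncompact O_sup Q_C1 Q_proj F, of V B] by simp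
    then show False using I by contradiction
  qed
  moreover have "?II" if III: "?III"
  proof -
    let ?F = "\<lambda>(z :: (real^'s) \<times> (real^'s^'s)) q :: real^'s^'s^'s. (norm q)\<^sup>2"
    obtain C where C: "C > 0" and le: "\<And>V B. varifold m Nbar N V \<Longrightarrow> gen_curvature V B \<Longrightarrow>
        emeasure V (space V) \<le> ennreal C * (\<integral>\<^sup>+ z. ennreal (?F z (sff Q B z)) \<partial>V)"
      using III condF_norm_squared by blast
    have "measure V (space V) \<le> C * enn2real (\<integral>\<^sup>+ z. ennreal (?F z (sff Q B z)) \<partial>V)"
      if "varifold m Nbar N V" "gen_curvature V B" "(\<integral>\<^sup>+ z. ennreal (?F z (sff Q B z)) \<partial>V) \<noteq> \<infinity>" for V B
    proof -
      \<comment> \<open>\<open>enn2real\<close> sends infinity to 0, so the passage to real numbers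
        is monotone only because the energy is finite.\<close>
      have "enn2real (emeasure V (space V)) \<le> enn2real (ennreal C * (\<integral>\<^sup>+ z. ennreal (?F z (sff Q B z)) \<partial>V))"
        using that by (intro enn2real_mono le) (auto simp: ennreal_mult_less_top top.not_eq_extremum)
      then show ?thesis
        using C by (simp add: measure_def enn2real_mult)
    qed
    moreover have "mono_on {0..} (\<lambda>t. C * t)"
      using C by (auto simp: mono_on_def)
    ultimately show ?thesis
      using C condF_norm_squared by (intro exI[of _ "\<lambda>t. C * t"] exI[of _ ?F]) auto
  qed
  moreover have "?I" if "?II"
  proof
    assume "\<exists>V B. varifold m Nbar N V \<and> emeasure V (space V) \<noteq> 0 \<and> gen_curvature V B \<and>
              (AE z in V. sff Q B z = 0)"
    then obtain V B where V: "varifold m Nbar N V" "emeasure V (space V) \<noteq> 0" "gen_curvature V B"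
      and flat: "AE z in V. sff Q B z = 0"
      by blast
    obtain \<Phi> :: "real \<Rightarrow> real" and F where \<Phi>: "\<Phi> 0 = 0" and F: "condF (Gm m Nbar N) F"
      and le: "(\<integral>\<^sup>+ z. ennreal (F z (sff Q B z)) \<partial>V) \<noteq> \<infinity> \<Longrightarrow>
           measure V (space V) \<le> \<Phi> (enn2real (\<integral>\<^sup>+ z. ennreal (F z (sff Q B z)) \<partial>V))"
      using \<open>?II\<close> V by blast
    \<comment> \<open>Condition (F) speaks of points of the Grassmann bundle only, so
      \<open>F z 0 = 0\<close> is used together with the fact that \<open>V\<close> is carried
      there.\<close>
    have "AE z in V. ennreal (F z (sff Q B z)) = 0"
      using flat varifoldD(3)[OF V(1) G]
      by eventually_elim (use F in \<open>auto simp: condF_def\<close>)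
    then have "(\<integral>\<^sup>+ z. ennreal (F z (sff Q B z)) \<partial>V) = (\<integral>\<^sup>+ z. 0 \<partial>V)"
      by (rule nn_integral_cong_AE)
    then have "measure V (space V) \<le> 0"
      using le \<Phi> by simp
    then have "emeasure V (space V) = 0"
      using finite_measure.emeasure_eq_measure[OF varifoldD(2)[OF V(1) G]] by (simp add: ennreal_neg)
    then show False using V(2) by simp
  qed
  ultimately show ?thesis by blast
qed

end
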